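(* Let $a\ge 2$ be an integer, let $p\in\mathbb{Z}[n]$ be a polynomial that is eventually increasing and eventually non-negative, and let $(f(n))_{n\ge1}$ be a sequence of integers such that $$\lambda_n=a^{p(n)}+f(n)\qquad(n\ge1)$$ is a sequence of positive integers. Put $$\theta_n=\log\left(1+f(n)a^{-p(n)}\right).$$ If there exist $0<\rho<1$ and $n_0\ge1$ such that $$0<|\theta_{n+1}|\le\rho|\theta_n|\qquad(n\ge n_0),$$ then $(\lambda_n)_{n\ge1}$ is neither $L^\infty$-Khintchin nor $L^1$-Khintchin. In particular, for every integer $a\ge2$, every polynomial $p\in\mathbb{Z}[n]$ that is eventually increasing and eventually non-negative, and every $c\in\mathbb{Z}\setminus\{0\}$, every positive tail of $(a^{p(n)}+c)_{n\ge1}$ is neither $L^\infty$-Khintchin nor $L^1$-Khintchin; that is, whenever $h\ge0$ is an integer such that $a^{p(n)}+c$ is a positive integer for all $n>h$, the sequence $(a^{p(n+h)}+c)_{n\ge1}$ is neither $L^\infty$-Khintchin nor $L^1$-Khintchin.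
   Context: $\mathbb{T}=\mathbb{R}/\mathbb{Z}$ is the circle group with its Haar probability measure $m$. For a sequence $\lambda=(\lambda_n)_{n\ge1}$ of positive integers and a measurable function $g$ on $\mathbb{T}$, put $A_N^\lambda g(x)=\frac1N\sum_{n\le N}g(\lambda_n x)$, $x\in\mathbb{T}$. For $1\le q\le\infty$, the sequence $\lambda$ is called $L^q$-Khintchin if, for every $g\in L^q(\mathbb{T})$, $A_N^\lambda g(x)\to\int_{\mathbb{T}}g\,dm$ as $N\to\infty$ for $m$-a.e. $x\in\mathbb{T}$. *)

theory Defs
  imports "HOL-Analysis.Analysis" "HOL-Computational_Algebra.Polynomial"
begin

text \<open>The circle group \<open>\<real>/\<int>\<close>, with the quotient topology.\<close>

quotient_type circle = real / "\<lambda>x y. x - y \<in> \<int>"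
proof (rule equivpI)
  show "reflp (\<lambda>x y::real. x - y \<in> \<int>)"
    by (rule reflpI) simp
  show "symp (\<lambda>x y::real. x - y \<in> \<int>)"
    by (rule sympI) (metis Ints_minus minus_diff_eq)
  show "transp (\<lambda>x y::real. x - y \<in> \<int>)"
    by (rule transpI) (metis Ints_add diff_add_cancel add_diff_eq)
qed

instantiation circle :: ab_group_add
begin

lift_definition zero_circle :: circle is 0 .

lift_definition plus_circle :: "circle \<Rightarrow> circle \<Rightarrow> circle" is "(+)"
  by (metis Ints_add add_diff_add)

lift_definition uminus_circle :: "circle \<Rightarrow> circle" is uminus
  by (metis Ints_minus minus_diff_minus)

lift_definition minus_circle :: "circle \<Rightarrow> circle \<Rightarrow> circle" is "(-)"
proof -
  fix x y u v :: real
  assume "x - y \<in> \<int>" "u - v \<in> \<int>"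
  then have "(x - y) - (u - v) \<in> \<int>" by (rule Ints_diff)
  moreover have "(x - u) - (y - v) = (x - y) - (u - v)" by (simp add: algebra_simps)
  ultimately show "(x - u) - (y - v) \<in> \<int>" by metis
qed

instance
  by standard (transfer; simp)+

end

instantiation circle :: topological_space
begin

definition open_circle :: "circle set \<Rightarrow> bool" where
  "open_circle U \<longleftrightarrow> open (abs_circle -` U)"

instance
proof
  show "open (UNIV :: circle set)"
    by (simp add: open_circle_def)
  show "open (S \<inter> T)" if "open S" "open T" for S T :: "circle set"
    using that by (simp add: open_circle_def open_Int)
  show "open (\<Union>K)" if "\<forall>S\<in>K. open S" for K :: "circle set set"
    using that by (auto simp: open_circle_def vimage_Union)
qed

end

lift_definition circle_mult :: "nat \<Rightarrow> circle \<Rightarrow> circle" is "\<lambda>n x. of_nat n * x"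
  by (metis Ints_mult Ints_of_nat right_diff_distrib)

lemma circle_mult_0 [simp]: "circle_mult 0 x = 0"
  by transfer simp

lemma circle_mult_Suc: "circle_mult (Suc n) x = x + circle_mult n x"
  by transfer (simp add: algebra_simps)

lemma circle_mult_eq_sum: "circle_mult n x = (\<Sum>i<n. x)"
  by (induction n) (simp_all add: circle_mult_Suc add.commute)

text \<open>
  Haar probability measure: the image of Lebesgue measure on \<open>[0,1)\<close>.  The lemmas
  \<open>emeasure_haar_space\<close> and \<open>haar_translation_invariant\<close> below confirm that it is the
  translation-invariant Borel probability measure of the circle.
\<close>

definition haar :: "circle measure" where
  "haar = distr (restrict_space lborel {0..<1}) borel abs_circle"

lemma measurable_abs_circle [measurable]: "abs_circle \<in> borel_measurable borel"
  by (rule borel_measurable_continuous_onI)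
     (simp add: continuous_on_open_vimage open_circle_def)

lemma measurable_abs_circle_restrict:
  "abs_circle \<in> restrict_space lborel {0..<1} \<rightarrow>\<^sub>M borel"
  by (intro measurable_restrict_space1) simp

lemma sets_haar [simp, measurable_cong]: "sets haar = sets borel"
  and space_haar [simp]: "space haar = UNIV"
  by (simp_all add: haar_def)

lemma emeasure_haar:
  assumes "A \<in> sets borel"
  shows "emeasure haar A = emeasure lborel (abs_circle -` A \<inter> {0..<1})"
proof -
  have "abs_circle -` A \<in> sets borel"
    using measurable_sets[OF measurable_abs_circle assms] by simp
  then show ?thesis
    using assms unfolding haar_def
    by (subst emeasure_distr[OF measurable_abs_circle_restrict])
       (auto simp: space_restrict_space emeasure_restrict_space)
qed

lemma emeasure_haar_space: "emeasure haar (space haar) = 1"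
  by (simp add: emeasure_haar)

lemma haar_translation_invariant: "distr haar borel ((+) t) = haar"
proof (rule measure_eqI)
  show "sets (distr haar borel ((+) t)) = sets haar"
    by simp
next
  fix A assume "A \<in> sets (distr haar borel ((+) t))"
  then have A: "A \<in> sets borel" by simp
  have "\<exists>s. t = abs_circle s \<and> 0 \<le> s \<and> s < 1"
  proof -
    obtain r where r: "t = abs_circle r" by (induction t rule: circle.abs_induct) blast
    have "r - frac r \<in> \<int>" by (simp add: frac_def)
    then have "t = abs_circle (frac r)"
      unfolding r by (simp add: circle.abs_eq_iff)
    then show ?thesis using frac_ge_0 frac_lt_1 by blast
  qed
  then obtain s where s: "t = abs_circle s" "0 \<le> s" "s < 1" by blast
  define P where "P = abs_circle -` A"
  have P: "P \<in> sets borel"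
    unfolding P_def using measurable_sets[OF measurable_abs_circle A] by simp
  have per: "x + 1 \<in> P \<longleftrightarrow> x \<in> P" for x
  proof -
    have "abs_circle (x + 1) = abs_circle x" by (simp add: circle.abs_eq_iff)
    then show ?thesis by (simp add: P_def)
  qed
  have tr: "emeasure lborel ((\<lambda>x. c + x) -` B) = emeasure lborel B"
    if "B \<in> sets borel" for B and c :: real
  proof -
    have "emeasure lborel B = emeasure (distr lborel borel ((+) c)) B"
      by (simp add: lborel_distr_plus)
    also have "\<dots> = emeasure lborel ((\<lambda>x. c + x) -` B)"
      using that by (subst emeasure_distr) auto
    finally show ?thesis by simp
  qed
  have plus_meas: "(+) t \<in> borel_measurable borel"
  proof (rule borel_measurable_continuous_onI)
    have *: "abs_circle -` ((+) t -` U) = (\<lambda>x. s + x) -` (abs_circle -` U)" for U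
      by (auto simp: s(1) plus_circle.abs_eq)
    show "continuous_on UNIV ((+) t)"
    proof -
      have "open ((\<lambda>x. s + x) -` V)" if "open V" for V
        using that by (intro open_vimage continuous_intros)
      then show ?thesis
        unfolding continuous_on_open_vimage[OF open_UNIV] open_circle_def by (simp add: *)
    qed
  qed
  have "emeasure (distr haar borel ((+) t)) A = emeasure haar ((+) t -` A)"
    using A plus_meas by (subst emeasure_distr) (auto simp: measurable_def)
  also have "\<dots> = emeasure lborel (abs_circle -` ((+) t -` A) \<inter> {0..<1})"
    using measurable_sets[OF plus_meas A] by (intro emeasure_haar) simp
  also have "abs_circle -` ((+) t -` A) \<inter> {0..<1} = (\<lambda>x. s + x) -` (P \<inter> {s..<s+1})"
    by (auto simp: P_def s(1) plus_circle.abs_eq)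
  also have "emeasure lborel \<dots> = emeasure lborel (P \<inter> {s..<s+1})"
    using P by (intro tr) auto
  also have "P \<inter> {s..<s+1} = (P \<inter> {s..<1}) \<union> (P \<inter> {1..<1+s})"
    using s by auto
  also have "emeasure lborel \<dots> = emeasure lborel (P \<inter> {s..<1}) + emeasure lborel (P \<inter> {1..<1+s})"
    using P by (intro plus_emeasure[symmetric]) auto
  also have "emeasure lborel (P \<inter> {1..<1+s}) = emeasure lborel ((\<lambda>x. 1 + x) -` (P \<inter> {1..<1+s}))"
    using P by (intro tr[symmetric]) auto
  also have "(\<lambda>x. 1 + x) -` (P \<inter> {1..<1+s}) = P \<inter> {0..<s}"
    using per by (auto simp: add.commute)
  also have "emeasure lborel (P \<inter> {s..<1}) + emeasure lborel (P \<inter> {0..<s})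
      = emeasure lborel ((P \<inter> {s..<1}) \<union> (P \<inter> {0..<s}))"
    using P by (intro plus_emeasure) auto
  also have "(P \<inter> {s..<1}) \<union> (P \<inter> {0..<s}) = P \<inter> {0..<1}"
    using s by auto
  also have "emeasure lborel (P \<inter> {0..<1}) = emeasure haar A"
    using A by (simp add: emeasure_haar P_def)
  finally show "emeasure (distr haar borel ((+) t)) A = emeasure haar A" .
qed

text \<open>
  \<open>L\<^sup>q\<close> of the circle, complex-valued, with genuine functions in place of classes modulo
  null sets.  Only \<open>1 \<le> q \<le> \<infinity>\<close> is meaningful.
\<close>

definition Lq_circle :: "ennreal \<Rightarrow> (circle \<Rightarrow> complex) set" where
  "Lq_circle q = {g \<in> borel_measurable haar.
     if q = \<infinity> then \<exists>C. AE x in haar. norm (g x) \<le> C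
     else integrable haar (\<lambda>x. norm (g x) powr enn2real q)}"

text \<open>Sequences \<open>(\<lambda>\<^sub>n)\<^sub>n\<^sub>\<ge>\<^sub>1\<close> are functions on \<^typ>\<open>nat\<close> whose value at \<open>0\<close> is ignored.\<close>

definition ergodic_avg :: "(nat \<Rightarrow> nat) \<Rightarrow> (circle \<Rightarrow> complex) \<Rightarrow> nat \<Rightarrow> circle \<Rightarrow> complex" where
  "ergodic_avg l g N x = (\<Sum>n=1..N. g (circle_mult (l n) x)) / of_nat N"

definition khintchin :: "ennreal \<Rightarrow> (nat \<Rightarrow> nat) \<Rightarrow> bool" where
  "khintchin q l \<longleftrightarrow>
     (\<forall>g \<in> Lq_circle q. AE x in haar. (\<lambda>N. ergodic_avg l g N x) \<longlonglongrightarrow> (LINT y|haar. g y))"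

text \<open>
  Monotonicity is meant in the weak sense.  For a nonconstant polynomial, weak and strict
  eventual monotonicity coincide, so constants are the only additional case.
\<close>

definition eventually_increasing :: "int poly \<Rightarrow> bool" where
  "eventually_increasing p \<longleftrightarrow> (\<exists>n1::nat. mono_on {n1..} (\<lambda>n. poly p (int n)))"

definition eventually_nonneg :: "int poly \<Rightarrow> bool" where
  "eventually_nonneg p \<longleftrightarrow> (\<forall>\<^sub>F n in sequentially. 0 \<le> poly p (int n))"

end

theory Submission
  imports Defs "HOL-Library.Nat_Bijection" "HOL-Library.Log_Nat"
begin

text \<open>
  For an integer \<open>r\<close> put \<open>\<phi>(k) = r ln k / ln a\<close> modulo \<open>1\<close>.  This is a character of the multiplicative
  group of positive rationals, and it is trivial on the powers of \<open>a\<close>; hence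
  \<open>\<phi>(\<lambda>\<^sub>n) = r \<theta>\<^sub>n / ln a\<close> sees the perturbation \<open>\<theta>\<^sub>n\<close> alone.  Since \<open>\<theta>\<close> decays
  geometrically, it decays by a factor of at least \<open>5\<close> at each step along the multiples of some fixed \<open>L\<close>.  An integer \<open>r\<close> can then be chosen so that the numbers \<open>\<phi>(\<lambda>\<^sub>n)\<close>, for \<open>n\<close>
  in a finite stretch of multiples of \<open>L\<close>, lie within \<open>1/8\<close> of any prescribed sequence of values
  \<open>0\<close> and \<open>1/2\<close> (\<open>lacunary_interpolation_int\<close>).

  With \<open>m\<close> such characters, prescribe on consecutive dyadic blocks of indices all \<open>2\<^sup>m\<close> patterns in
  \<open>{0, 1/2}\<^sup>m\<close>.  Let \<open>S\<close> be the set of those \<open>k\<close> for which every one of the \<open>m\<close> character values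
  avoids a certain quarter of the circle.  A suitable choice of the quarters gives \<open>S\<close> density at
  most \<open>(3/4)\<^sup>m\<close> in a given finite set of integers.  Yet for each \<open>j\<close> there is a block whose pattern moves
  all character values of \<open>j\<close> out of the forbidden quarters, so that \<open>j / \<lambda>\<^sub>n \<in> S\<close> for all multiples \<open>n\<close> of
  \<open>L\<close> in the block: a proportion of at least \<open>1/(2L)\<close> of all indices up to the end of the block.  The
  proportion \<open>1/(2L)\<close> stays fixed while the density \<open>(3/4)\<^sup>m\<close> tends to \<open>0\<close>.  Carried out inside a
  Foelner set of the multiplicative semigroup generated by the \<open>\<lambda>\<^sub>n\<close>, this becomes a statement
  about finite sets of integers (\<open>lacunary_sweeping\<close>).

  That statement is transferred to the circle by a Rokhlin tower.  If \<open>B\<close> is the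
  arc of length \<open>1/Q\<^sup>2\<close> that starts at \<open>1/Q\<close>, then the preimages of \<open>B\<close> under \<open>x \<mapsto> j x\<close> are pairwise disjoint for \<open>j < Q\<close>, and
  \<open>j x \<in> B\<close> together with \<open>j = \<lambda>\<^sub>n k\<close> puts \<open>\<lambda>\<^sub>n x\<close> into the preimage of \<open>B\<close> under \<open>x \<mapsto> k x\<close>.  Repeating the
  tower independently at the scales \<open>1, g, g\<^sup>2, \<dots>\<close> makes it cover half of the circle (\<open>tower\<close>).  The result
  is, for every \<open>\<epsilon>\<close>, a set \<open>E\<close> of measure at most \<open>\<epsilon>\<close> that is visited with frequency at least \<open>c\<close> by the
  points of a set of measure at least \<open>1/2\<close>, with \<open>c\<close> independent of \<open>\<epsilon>\<close>.  The indicator function of a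
  union of such sets \<open>E\<close> is bounded, and on a set of positive measure its averages exceed its
  integral by a fixed amount infinitely often (\<open>not_khintchin_if_sweeping\<close>).

  The sequences \<open>a\<^bsup>p(n)\<^esup> + c\<close> with \<open>p\<close> nonconstant are of this kind with ratio \<open>3/4\<close>.  If \<open>p\<close> is
  constant, then so is the sequence, and the averages of an indicator function take only the values
  \<open>0\<close> and \<open>1\<close>.
\<close>

section \<open>Dilations of the circle\<close>

lemma measure_haar_UNIV [simp]: "measure haar UNIV = 1"
  using emeasure_haar_space by (simp add: measure_def)

interpretation haar: finite_measure haar
  by standard (use emeasure_haar_space in simp)

lemma circle_mult_abs: "circle_mult n (abs_circle x) = abs_circle (real n * x)"
  by (simp add: circle_mult.abs_eq)

lemma circle_mult_mult: "circle_mult m (circle_mult n x) = circle_mult (m * n) x"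
  by (induction x rule: circle.abs_induct) (simp add: circle_mult_abs mult.assoc)

lemma measurable_circle_mult [measurable]: "circle_mult n \<in> borel_measurable borel"
proof (rule borel_measurable_continuous_onI)
  have "abs_circle -` (circle_mult n -` U) = (\<lambda>x. real n * x) -` (abs_circle -` U)" for U
    by (auto simp: circle_mult_abs)
  moreover have "open ((\<lambda>x. real n * x) -` V)" if "open V" for V
    using that by (intro open_vimage continuous_intros)
  ultimately show "continuous_on UNIV (circle_mult n)"
    unfolding continuous_on_open_vimage[OF open_UNIV] open_circle_def by simp
qed

lemma borel_vimage_circle_mult:
  "G \<in> sets borel \<Longrightarrow> circle_mult n -` G \<in> sets borel"
  using measurable_sets[OF measurable_circle_mult, of G n] by simp

lemma measure_haar:
  assumes "A \<in> sets borel"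
  shows "measure haar A = measure lborel (abs_circle -` A \<inter> {0..<1})"
  using emeasure_haar[OF assms] by (simp add: measure_def)

lemma abs_circle_eq_iff: "abs_circle x = abs_circle y \<longleftrightarrow> x - y \<in> \<int>"
  by (rule circle.abs_eq_iff)

lemma abs_circle_add_int: "abs_circle (x + of_int i) = abs_circle x"
  by (simp add: abs_circle_eq_iff)

text \<open>
  The map \<open>x \<mapsto> g x\<close> stretches a cell \<open>[i/g, (i+1)/g)\<close> affinely onto a full period.
\<close>

lemma emeasure_periodic_cell:
  fixes i :: int and g :: nat
  assumes "G \<in> sets borel" and "g > 0"
  shows "emeasure lborel {x. \<lfloor>real g * x\<rfloor> = i \<and> abs_circle (real g * x) \<in> G}
    = ennreal (1 / real g) * emeasure haar G"
proof -
  define P where "P = abs_circle -` G"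
  have P [measurable]: "P \<in> sets borel"
    unfolding P_def using measurable_sets[OF measurable_abs_circle assms(1)] by simp
  let ?A = "{x. \<lfloor>real g * x\<rfloor> = i \<and> abs_circle (real g * x) \<in> G}"
  let ?f = "\<lambda>y::real. of_int i / real g + (1 / real g) * y"
  have A: "?A \<in> sets borel"
  proof -
    have "?A = (\<lambda>x. real g * x) -` (P \<inter> {of_int i..<of_int i + 1})"
      by (auto simp: P_def floor_eq_iff)
    moreover have "(\<lambda>x. real g * x) \<in> borel_measurable borel" by simp
    ultimately show ?thesis
      using measurable_sets[of "\<lambda>x. real g * x" borel borel "P \<inter> {of_int i..<of_int i + 1}"] P
      by simp
  qed
  have f: "real g * ?f y = y + of_int i" for y
    using assms(2) by (simp add: field_simps)
  have "emeasure lborel ?A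
      = emeasure (density (distr lborel borel ?f) (\<lambda>_. ennreal \<bar>1 / real g\<bar>)) ?A"
    using assms(2) by (subst lborel_real_affine[of "1 / real g" "of_int i / real g"]) simp_all
  also have "\<dots> = ennreal (1 / real g) * emeasure (distr lborel borel ?f) ?A"
    using A by (simp add: emeasure_density_const)
  also have "emeasure (distr lborel borel ?f) ?A = emeasure lborel (?f -` ?A)"
    using A by (subst emeasure_distr) auto
  also have "?f -` ?A = P \<inter> {0..<1}"
    unfolding vimage_def mem_Collect_eq f P_def
    by (auto simp: abs_circle_add_int floor_eq_iff)
  also have "emeasure lborel \<dots> = emeasure haar G"
    using assms(1) by (simp add: emeasure_haar P_def)
  finally show ?thesis .
qed

text \<open>
  Unions of the cells \<open>[i/g, (i+1)/g)\<close>, that is, events that depend only on the first digit in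
  base \<open>g\<close>.
\<close>

definition cellular :: "nat \<Rightarrow> circle set \<Rightarrow> bool" where
  "cellular g A \<longleftrightarrow> (\<forall>x y. \<lfloor>real g * x\<rfloor> = \<lfloor>real g * y\<rfloor> \<longrightarrow>
     (abs_circle x \<in> A \<longleftrightarrow> abs_circle y \<in> A))"

lemma emeasure_cellular_Int:
  assumes A: "cellular g A" and G: "G \<in> sets borel" "A \<in> sets borel" and g: "g > 0"
  shows "emeasure haar (A \<inter> circle_mult g -` G)
    = of_nat (card {i\<in>{0..<int g}. abs_circle (of_int i / real g) \<in> A})
      * (ennreal (1 / real g) * emeasure haar G)"
proof -
  define S where "S = {i\<in>{0..<int g}. abs_circle (of_int i / real g) \<in> A}"
  let ?C = "\<lambda>i. {x. \<lfloor>real g * x\<rfloor> = i \<and> abs_circle (real g * x) \<in> G}"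
  have AS: "abs_circle x \<in> A \<longleftrightarrow> abs_circle (of_int \<lfloor>real g * x\<rfloor> / real g) \<in> A" for x
    using A g unfolding cellular_def by (metis (no_types) floor_of_int less_irrefl
        nonzero_mult_div_cancel_left of_nat_eq_0_iff times_divide_eq_right)
  have fl: "\<lfloor>real g * x\<rfloor> \<in> {0..<int g} \<longleftrightarrow> x \<in> {0..<1}" for x
  proof -
    have "\<lfloor>real g * x\<rfloor> < int g \<longleftrightarrow> real g * x < real g * 1"
      by (simp add: floor_less_iff)
    then show ?thesis using g by (simp add: zero_le_mult_iff)
  qed
  have "abs_circle -` (A \<inter> circle_mult g -` G) \<inter> {0..<1} = (\<Union>i\<in>S. ?C i)"
  proof (intro set_eqI)
    fix x
    show "x \<in> abs_circle -` (A \<inter> circle_mult g -` G) \<inter> {0..<1} \<longleftrightarrow> x \<in> (\<Union>i\<in>S. ?C i)"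
      using fl[of x] AS[of x] by (auto simp: S_def circle_mult_abs)
  qed
  moreover have "A \<inter> circle_mult g -` G \<in> sets borel"
    using G borel_vimage_circle_mult by blast
  ultimately have "emeasure haar (A \<inter> circle_mult g -` G) = emeasure lborel (\<Union>i\<in>S. ?C i)"
    by (simp add: emeasure_haar)
  also have "\<dots> = (\<Sum>i\<in>S. emeasure lborel (?C i))"
  proof (rule sum_emeasure[symmetric])
    show "?C ` S \<subseteq> sets lborel"
    proof -
      have "(\<lambda>x::real. abs_circle (real g * x)) \<in> borel_measurable borel" by measurable
      then have "(\<lambda>x::real. abs_circle (real g * x)) -` G \<in> sets borel"
        using measurable_sets[of _ borel borel G] G by fastforce
      moreover have "{x. \<lfloor>real g * x\<rfloor> = i} \<in> sets borel" for i
      proof -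
        have "{x. \<lfloor>real g * x\<rfloor> = i} = (\<lambda>x. real g * x) -` {of_int i..<of_int i + 1}"
          by (auto simp: floor_eq_iff)
        moreover have "(\<lambda>x. real g * x) -` {of_int i..<of_int i + 1::real} \<in> sets borel"
          using measurable_sets[of "\<lambda>x. real g * x" borel borel "{of_int i..<of_int i + 1}"] by simp
        ultimately show ?thesis by simp
      qed
      moreover have "?C i = {x. \<lfloor>real g * x\<rfloor> = i} \<inter> (\<lambda>x::real. abs_circle (real g * x)) -` G" for i
        by auto
      ultimately show ?thesis by auto
    qed
    show "disjoint_family_on ?C S" by (auto simp: disjoint_family_on_def)
    show "finite S" by (rule finite_subset[of _ "{0..<int g}"]) (auto simp: S_def)
  qed
  also have "\<dots> = of_nat (card S) * (ennreal (1 / real g) * emeasure haar G)"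
    using emeasure_periodic_cell[OF G(1) g] by simp
  finally show ?thesis by (simp add: S_def)
qed

text \<open>
  Independence of the first base-\<open>g\<close> digit from the later ones, which are the digits of \<open>g x\<close>.
\<close>

lemma measure_cellular_Int:
  assumes "cellular g A" "G \<in> sets borel" "A \<in> sets borel" "g > 0"
  shows "measure haar (A \<inter> circle_mult g -` G) = measure haar A * measure haar G"
proof -
  define s where "s = card {i\<in>{0..<int g}. abs_circle (of_int i / real g) \<in> A}"
  have *: "measure haar (A \<inter> circle_mult g -` H) = real s / real g * measure haar H"
    if "H \<in> sets borel" for H
    using emeasure_cellular_Int[OF assms(1) that assms(3,4)]
    by (simp add: measure_def enn2real_mult s_def)
  have "measure haar A = real s / real g"
    using *[of UNIV] by simp
  then show ?thesis using *[OF assms(2)] by simp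
qed

lemma measure_vimage_circle_mult:
  assumes "G \<in> sets borel" "k > 0"
  shows "measure haar (circle_mult k -` G) = measure haar G"
  using measure_cellular_Int[of k UNIV G] assms by (simp add: cellular_def)

text \<open>
  The factor \<open>h\<close> allows finitely many such preimages to be refined to one common base.
\<close>

lemma cellular_vimage_circle_mult:
  assumes "cellular g A" "h > 0"
  shows "cellular (g * j * h) (circle_mult j -` A)"
  unfolding cellular_def
proof (intro allI impI)
  fix x y :: real
  assume eq: "\<lfloor>real (g * j * h) * x\<rfloor> = \<lfloor>real (g * j * h) * y\<rfloor>"
  have "\<lfloor>real g * (real j * z)\<rfloor> = \<lfloor>real (g * j * h) * z\<rfloor> div int h" for z
  proof -
    have "real g * (real j * z) = (real (g * j * h) * z) / real h"
      using assms(2) by simp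
    then show ?thesis
      using floor_divide_real_eq_div[of "int h" "real (g * j * h) * z"] by simp
  qed
  then have "\<lfloor>real g * (real j * x)\<rfloor> = \<lfloor>real g * (real j * y)\<rfloor>" by (simp only: eq)
  with assms(1) have "abs_circle (real j * x) \<in> A \<longleftrightarrow> abs_circle (real j * y) \<in> A"
    unfolding cellular_def by blast
  then show "abs_circle x \<in> circle_mult j -` A \<longleftrightarrow> abs_circle y \<in> circle_mult j -` A"
    by (simp add: circle_mult_abs)
qed

lemma cellular_UN: "(\<And>i. i \<in> I \<Longrightarrow> cellular g (A i)) \<Longrightarrow> cellular g (\<Union>i\<in>I. A i)"
  unfolding cellular_def by blast

lemma cellular_Compl: "cellular g A \<Longrightarrow> cellular g (- A)"
  unfolding cellular_def by blast

lemma measure_cellular_power: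
  assumes A: "cellular g A" "A \<in> sets borel" "g > 0"
  shows "measure haar {x. \<forall>i<n. circle_mult (g ^ i) x \<in> A} = measure haar A ^ n"
    and "{x. \<forall>i<n. circle_mult (g ^ i) x \<in> A} \<in> sets borel"
proof (induction n)
  case 0
  { case 1 show ?case by simp }
  { case 2 show ?case by simp }
next
  case (Suc n)
  let ?V = "\<lambda>n. {x. \<forall>i<n. circle_mult (g ^ i) x \<in> A}"
  have "circle_mult 1 x = x" for x
    by (induction x rule: circle.abs_induct) (simp add: circle_mult_abs)
  then have V: "?V (Suc n) = A \<inter> circle_mult g -` ?V n"
    by (auto simp: circle_mult_mult less_Suc_eq_0_disj mult.commute)
  { case 1 show ?case
      unfolding V using measure_cellular_Int[OF A(1) Suc(2) A(2,3)] Suc(1) by simp }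
  { case 2 show ?case
      unfolding V using A(2) borel_vimage_circle_mult[OF Suc(2)] by auto }
qed

section \<open>Rokhlin towers over a short arc\<close>

text \<open>
  The base of the tower.  The multiples \<open>j/Q\<close> with \<open>j < Q\<close> of its left end are at least \<open>1/Q\<close> apart modulo
  \<open>1\<close>, and dilation by such a \<open>j\<close> stretches its length \<open>1/Q\<^sup>2\<close> to less than \<open>1/Q\<close>.
\<close>

definition small_arc :: "nat \<Rightarrow> circle set" where
  "small_arc Q = abs_circle ` {1 / real Q ..< 1 / real Q + 1 / real Q ^ 2}"

lemma small_arc_iff:
  "abs_circle y \<in> small_arc Q \<longleftrightarrow>
     (\<exists>z::int. 1 / real Q \<le> y - of_int z \<and> y - of_int z < 1 / real Q + 1 / real Q ^ 2)"
proof
  assume "abs_circle y \<in> small_arc Q"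
  then obtain x where x: "1 / real Q \<le> x" "x < 1 / real Q + 1 / real Q ^ 2" "y - x \<in> \<int>"
    by (auto simp: small_arc_def abs_circle_eq_iff)
  from x(3) obtain z where "y - x = of_int z" by (elim Ints_cases)
  then have "y - of_int z = x" by simp
  with x show "\<exists>z::int. 1 / real Q \<le> y - of_int z \<and> y - of_int z < 1 / real Q + 1 / real Q ^ 2"
    by metis
next
  assume "\<exists>z::int. 1 / real Q \<le> y - of_int z \<and> y - of_int z < 1 / real Q + 1 / real Q ^ 2"
  then obtain z :: int where z: "1 / real Q \<le> y - of_int z" "y - of_int z < 1 / real Q + 1 / real Q ^ 2"
    by blast
  have "abs_circle y = abs_circle (y - of_int z)" by (simp add: abs_circle_eq_iff)
  then show "abs_circle y \<in> small_arc Q" using z by (auto simp: small_arc_def)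
qed

lemma small_arc_iff_floor:
  assumes "Q > 0"
  shows "abs_circle y \<in> small_arc Q \<longleftrightarrow> (\<exists>z::int. \<lfloor>real (Q ^ 2) * y\<rfloor> = int Q + int (Q ^ 2) * z)"
proof -
  have "1 / real Q \<le> y - of_int z \<and> y - of_int z < 1 / real Q + 1 / real Q ^ 2 \<longleftrightarrow>
      \<lfloor>real (Q ^ 2) * y\<rfloor> = int Q + int (Q ^ 2) * z" for z
  proof -
    have Q: "real Q ^ 2 > 0" using assms by simp
    have "1 / real Q \<le> y - of_int z \<longleftrightarrow> real Q ^ 2 * (1 / real Q) \<le> real Q ^ 2 * (y - of_int z)"
      by (simp only: mult_le_cancel_left_pos[OF Q])
    moreover have "y - of_int z < 1 / real Q + 1 / real Q ^ 2 \<longleftrightarrow>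
        real Q ^ 2 * (y - of_int z) < real Q ^ 2 * (1 / real Q + 1 / real Q ^ 2)"
      using Q by (simp only: mult_less_cancel_left_pos)
    moreover have "real Q ^ 2 * (1 / real Q) = real Q" using assms by (simp add: power2_eq_square)
    moreover have "real Q ^ 2 * (1 / real Q + 1 / real Q ^ 2) = real Q + 1"
      using assms by (simp add: power2_eq_square field_simps)
    ultimately show ?thesis by (auto simp: floor_eq_iff algebra_simps)
  qed
  then show ?thesis by (simp add: small_arc_iff)
qed

lemma cellular_small_arc:
  assumes "Q > 0"
  shows "cellular (Q ^ 2) (small_arc Q)"
  unfolding cellular_def small_arc_iff_floor[OF assms] by (intro allI impI) (simp only:)

lemma closed_circle_singleton: "closed {y :: circle}"
proof (induction y rule: circle.abs_induct)
  case (1 r)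
  have "abs_circle -` (- {abs_circle r}) = - ((\<lambda>x. x - r) -` \<int>)"
    by (auto simp: abs_circle_eq_iff)
  moreover have "closed ((\<lambda>x::real. x - r) -` \<int>)"
    by (rule closed_vimage) (auto intro!: continuous_intros)
  ultimately show ?case by (simp add: closed_def open_circle_def open_Compl)
qed

lemma open_circle_image:
  assumes "open (U :: real set)"
  shows "open (abs_circle ` U)"
proof -
  have "abs_circle -` abs_circle ` U = (\<Union>z::int. (\<lambda>x. x - of_int z) -` U)"
  proof (intro set_eqI iffI)
    fix x assume "x \<in> abs_circle -` abs_circle ` U"
    then obtain u where u: "u \<in> U" "x - u \<in> \<int>" by (auto simp: abs_circle_eq_iff)
    from u(2) obtain z where "x - u = of_int z" by (elim Ints_cases)
    then have "x - of_int z = u" by simp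
    with u(1) show "x \<in> (\<Union>z::int. (\<lambda>x. x - of_int z) -` U)" by auto
  next
    fix x assume "x \<in> (\<Union>z::int. (\<lambda>x. x - of_int z) -` U)"
    then obtain z :: int where "x - of_int z \<in> U" by auto
    moreover have "abs_circle x = abs_circle (x - of_int z)" by (simp add: abs_circle_eq_iff)
    ultimately show "x \<in> abs_circle -` abs_circle ` U" by auto
  qed
  moreover have "open ((\<lambda>x::real. x - of_int z) -` U)" for z :: int
    using assms by (intro open_vimage continuous_intros)
  ultimately show ?thesis by (simp add: open_circle_def open_UN)
qed

lemma borel_small_arc:
  assumes "Q > 0"
  shows "small_arc Q \<in> sets borel"
proof -
  have "{1 / real Q ..< 1 / real Q + 1 / real Q ^ 2}
      = insert (1 / real Q) {1 / real Q <..< 1 / real Q + 1 / real Q ^ 2}"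
    using assms by auto
  then have "small_arc Q = {abs_circle (1 / real Q)} \<union> abs_circle ` {1 / real Q <..< 1 / real Q + 1 / real Q ^ 2}"
    by (simp add: small_arc_def)
  moreover have "{abs_circle (1 / real Q)} \<in> sets borel"
    by (intro borel_closed closed_circle_singleton)
  moreover have "abs_circle ` {1 / real Q <..< 1 / real Q + 1 / real Q ^ 2} \<in> sets borel"
    by (intro borel_open open_circle_image) auto
  ultimately show ?thesis by (simp only: sets.Un)
qed

lemma measure_small_arc:
  assumes "Q \<ge> 2"
  shows "measure haar (small_arc Q) = 1 / real Q ^ 2"
proof -
  have le: "1 / real Q + 1 / real Q ^ 2 \<le> 1"
  proof -
    have "1 / real Q \<le> 1/2" using assms by (simp add: field_simps)
    moreover have "1 / real Q ^ 2 \<le> 1 / real Q"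
      using assms by (intro divide_left_mono) (auto simp: power2_eq_square)
    ultimately show ?thesis by linarith
  qed
  have "abs_circle -` small_arc Q \<inter> {0..<1} = {1 / real Q ..< 1 / real Q + 1 / real Q ^ 2}"
  proof (intro set_eqI iffI)
    fix y assume y: "y \<in> abs_circle -` small_arc Q \<inter> {0..<1}"
    then obtain z :: int where z: "1 / real Q \<le> y - of_int z" "y - of_int z < 1 / real Q + 1 / real Q ^ 2"
      by (auto simp: small_arc_iff)
    have "0 \<le> 1 / real Q" by simp
    then have "y - of_int z < 1" "0 \<le> y - of_int z" using z le by linarith+
    then have "z = 0" using y by simp
    then show "y \<in> {1 / real Q ..< 1 / real Q + 1 / real Q ^ 2}" using z by simp
  next
    fix y assume y: "y \<in> {1 / real Q ..< 1 / real Q + 1 / real Q ^ 2}"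
    then have "0 \<le> y" "y < 1" using le by (auto intro: order_trans[of 0 "1 / real Q"])
    then show "y \<in> abs_circle -` small_arc Q \<inter> {0..<1}" using y by (auto simp: small_arc_def)
  qed
  then show ?thesis using borel_small_arc[of Q] assms by (simp add: measure_haar)
qed

text \<open>
  If \<open>i x = 1/Q + s\<close> and \<open>j x = 1/Q + t\<close> modulo \<open>1\<close>, eliminating \<open>x\<close> gives
  \<open>(j - i)/Q + (j s - i t) \<in> \<int>\<close> with an error term smaller than \<open>1/Q\<close> in absolute value; so \<open>Q\<close>
  divides \<open>j - i\<close>.
\<close>

lemma small_arc_preimages_disjoint:
  assumes "i < Q" "j < Q" "i \<noteq> j"
  shows "circle_mult i -` small_arc Q \<inter> circle_mult j -` small_arc Q = {}"
proof (rule ccontr)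
  assume "circle_mult i -` small_arc Q \<inter> circle_mult j -` small_arc Q \<noteq> {}"
  then obtain c where "circle_mult i c \<in> small_arc Q" "circle_mult j c \<in> small_arc Q" by auto
  moreover obtain x where "c = abs_circle x" by (induction c rule: circle.abs_induct) blast
  ultimately have "abs_circle (real i * x) \<in> small_arc Q" "abs_circle (real j * x) \<in> small_arc Q"
    by (simp_all add: circle_mult_abs)
  then obtain z w :: int where
    z: "1 / real Q \<le> real i * x - of_int z" "real i * x - of_int z < 1 / real Q + 1 / real Q ^ 2" and
    w: "1 / real Q \<le> real j * x - of_int w" "real j * x - of_int w < 1 / real Q + 1 / real Q ^ 2"
    unfolding small_arc_iff by blast
  have Q: "real Q > 0" using assms by simp
  \<comment> \<open>The offsets inside the arc, magnified by the factor Q.\<close>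
  define s t where "s = real Q * (real i * x - of_int z) - 1" and "t = real Q * (real j * x - of_int w) - 1"
  have bnd: "0 \<le> real Q * y - 1 \<and> real Q * (real Q * y - 1) < 1"
    if "1 / real Q \<le> y" "y < 1 / real Q + 1 / real Q ^ 2" for y
  proof -
    have "real Q * (1 / real Q) \<le> real Q * y" using that(1) Q by (intro mult_left_mono) auto
    moreover have "real Q ^ 2 * y < real Q ^ 2 * (1 / real Q + 1 / real Q ^ 2)"
      using that(2) Q by (intro mult_strict_left_mono) auto
    moreover have "real Q ^ 2 * (1 / real Q + 1 / real Q ^ 2) = real Q + 1"
      using Q by (simp add: power2_eq_square field_simps)
    ultimately show ?thesis using Q by (simp add: power2_eq_square algebra_simps)
  qed
  have s: "0 \<le> s" "real Q * s < 1" and t: "0 \<le> t" "real Q * t < 1"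
    using bnd[OF z] bnd[OF w] by (simp_all add: s_def t_def)
  have js: "0 \<le> real j * s" "real j * s < 1" and it: "0 \<le> real i * t" "real i * t < 1"
  proof -
    have "real j * s \<le> real Q * s" "real i * t \<le> real Q * t"
      using assms s t by (auto intro!: mult_right_mono)
    then show "real j * s < 1" "real i * t < 1" using s t by linarith+
    show "0 \<le> real j * s" "0 \<le> real i * t" using s t by simp_all
  qed
  have "real j * s - real i * t = real Q * (real i * of_int w - real j * of_int z) - (real j - real i)"
    by (simp add: s_def t_def algebra_simps)
  also have "\<dots> = of_int (int Q * (int i * w - int j * z) - (int j - int i))" by simp
  finally have "\<bar>int Q * (int i * w - int j * z) - (int j - int i)\<bar> < 1"
    using js it by linarith
  then have "int Q * (int i * w - int j * z) = int j - int i" by linarith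
  then have "int Q dvd int j - int i" by (metis dvd_triv_left)
  with assms(3) have "\<bar>int Q\<bar> \<le> \<bar>int j - int i\<bar>" by (intro dvd_imp_le_int) simp_all
  then show False using assms(1,2) by linarith
qed

text \<open>
  A single tower over a short arc has disjoint levels but a small total measure \<open>f\<close>.  Its union \<open>A\<close> is
  cellular for some base \<open>g\<close>, so its preimages under \<open>x \<mapsto> g\<^sup>i x\<close> are independent events of probability
  \<open>f\<close>, and about \<open>1/f\<close> of them cover at least half of the circle.  The exceptional set \<open>E\<close> grows at
  most by the same factor \<open>1/f\<close>, so its measure remains comparable to \<open>card K / card J\<close>.
\<close>

lemma tower:
  assumes J: "finite J" "J \<noteq> {}" "0 \<notin> J" and K: "finite K" "0 \<notin> K"
    and le: "real (card K) \<le> \<epsilon> * real (card J)"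
  shows "\<exists>E F. E \<in> sets borel \<and> F \<in> sets borel \<and> measure haar E \<le> 2 * \<epsilon> \<and> measure haar F \<ge> 1/2 \<and>
    (\<forall>x\<in>F. \<exists>j\<in>J. \<forall>d. \<forall>k\<in>K. d * k = j \<longrightarrow> circle_mult d x \<in> E)"
proof -
  define Q where "Q = Suc (Max J) + 2"
  have JQ: "j < Q" if "j \<in> J" for j using Max_ge[OF J(1) that] by (simp add: Q_def)
  have Q2: "Q \<ge> 2" by (simp add: Q_def)
  define b where "b = 1 / real Q ^ 2"
  have b: "b > 0" using Q2 by (simp add: b_def)
  have arcB: "small_arc Q \<in> sets borel" using borel_small_arc Q2 by simp
  have marc: "measure haar (circle_mult k -` small_arc Q) = b" if "k > 0" for k
    using measure_vimage_circle_mult[OF arcB that] measure_small_arc[OF Q2] by (simp add: b_def)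
  define A where "A = (\<Union>j\<in>J. circle_mult j -` small_arc Q)"
  define g where "g = Q ^ 2 * \<Prod>J"
  have g: "g > 0" using J Q2 by (auto simp: g_def intro!: Nat.gr0I)
  have "cellular g (circle_mult j -` small_arc Q)" if "j \<in> J" for j
  proof -
    have "g = Q ^ 2 * j * \<Prod>(J - {j})"
      using prod.remove[OF J(1) that, of "\<lambda>x. x"] by (simp add: g_def)
    moreover have "\<Prod>(J - {j}) > 0" using J by (auto intro!: Nat.gr0I)
    ultimately show ?thesis using cellular_vimage_circle_mult[OF cellular_small_arc] Q2 by simp
  qed
  then have cA: "cellular g A" unfolding A_def by (rule cellular_UN)
  have A: "A \<in> sets borel"
    unfolding A_def using J(1) borel_vimage_circle_mult[OF arcB] by (intro sets.finite_UN) auto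
  have mA: "measure haar A = real (card J) * b"
  proof -
    have "measure haar A = (\<Sum>j\<in>J. measure haar (circle_mult j -` small_arc Q))"
      unfolding A_def
    proof (rule haar.finite_measure_finite_Union)
      show "disjoint_family_on (\<lambda>j. circle_mult j -` small_arc Q) J"
        unfolding disjoint_family_on_def using small_arc_preimages_disjoint JQ by blast
    qed (use J borel_vimage_circle_mult[OF arcB] in auto)
    also have "\<dots> = (\<Sum>j\<in>J. b)" using J(3) by (intro sum.cong refl marc) (metis gr0I)
    finally show ?thesis by simp
  qed
  define f where "f = measure haar A"
  have f0: "f > 0" using mA b J by (simp add: f_def card_gt_0_iff)
  have f1: "f \<le> 1" using haar.bounded_measure[of A] by (simp add: f_def)
  define R where "R = nat \<lceil>1 / f\<rceil>"
  have R: "1 \<le> real R * f" "real R * f \<le> 2"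
  proof -
    have "1 / f \<le> real R" using f0 by (simp add: R_def)
    then show "1 \<le> real R * f" using f0 by (simp add: field_simps)
    have "real R \<le> 1 / f + 1" using f0 by (simp add: R_def)
    then have "real R * f \<le> (1 / f + 1) * f" using f0 by (intro mult_right_mono) auto
    then show "real R * f \<le> 2" using f0 f1 by (simp add: distrib_right)
  qed
  have C: "cellular g (- A)" "- A \<in> sets borel" using cellular_Compl[OF cA] borel_comp[OF A] by simp_all
  \<comment> \<open>the points missed by all the copies of the tower\<close>
  define V where "V = {x. \<forall>i<R. circle_mult (g ^ i) x \<in> - A}"
  have V: "V \<in> sets borel" "measure haar V = measure haar (- A) ^ R"
    unfolding V_def by (rule measure_cellular_power[OF C g])+
  have "measure haar (- A) = 1 - f"
    using haar.finite_measure_compl[of A] A by (simp add: f_def Compl_eq_Diff_UNIV)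
  then have "measure haar V = (1 - f) ^ R" using V by simp
  also have "\<dots> \<le> exp (- f) ^ R" using f1 exp_ge_add_one_self[of "- f"] by (intro power_mono) auto
  also have "\<dots> = exp (- (real R * f))" by (simp add: exp_of_nat_mult[symmetric])
  also have "\<dots> \<le> exp (- 1)" using R by simp
  also have "\<dots> \<le> 1/2"
    using exp_ge_add_one_self[of "1::real"] by (simp add: exp_minus field_simps)
  finally have mF: "measure haar (- V) \<ge> 1/2"
    using haar.finite_measure_compl[of V] V(1) by (simp add: Compl_eq_Diff_UNIV)
  define E where "E = (\<Union>i<R. \<Union>k\<in>K. circle_mult (g ^ i * k) -` small_arc Q)"
  have E: "E \<in> sets borel"
    unfolding E_def using K borel_vimage_circle_mult[OF arcB] by (intro sets.finite_UN) auto
  have Ek: "(\<Union>k\<in>K. circle_mult (g ^ i * k) -` small_arc Q) \<in> sets borel" for i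
    using K borel_vimage_circle_mult[OF arcB] by (intro sets.finite_UN) auto
  have "measure haar E \<le> (\<Sum>i<R. measure haar (\<Union>k\<in>K. circle_mult (g ^ i * k) -` small_arc Q))"
    unfolding E_def using Ek by (intro measure_UNION_le) auto
  also have "\<dots> \<le> (\<Sum>i<R. \<Sum>k\<in>K. measure haar (circle_mult (g ^ i * k) -` small_arc Q))"
    using K borel_vimage_circle_mult[OF arcB] by (intro sum_mono measure_UNION_le) auto
  also have "\<dots> = (\<Sum>i<R. \<Sum>k\<in>K. b)"
    using g K(2) by (intro sum.cong refl marc) (metis gr0I mult_eq_0_iff power_eq_0_iff)
  also have "\<dots> = real R * (real (card K) * b)" by simp
  also have "\<dots> \<le> real R * ((\<epsilon> * real (card J)) * b)"
    using le b by (intro mult_left_mono mult_right_mono) auto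
  also have "\<dots> = (real R * f) * \<epsilon>" by (simp add: f_def mA)
  also have "\<dots> \<le> 2 * \<epsilon>"
  proof -
    have "0 \<le> \<epsilon> * real (card J)" using le by (rule order_trans[rotated]) simp
    then have "0 \<le> \<epsilon>" using J by (simp add: zero_le_mult_iff card_gt_0_iff)
    then show ?thesis using R by (intro mult_right_mono) auto
  qed
  finally have mE: "measure haar E \<le> 2 * \<epsilon>" .
  have hit: "\<exists>j\<in>J. \<forall>d. \<forall>k\<in>K. d * k = j \<longrightarrow> circle_mult d x \<in> E" if "x \<in> - V" for x
  proof -
    from that obtain i j where ij: "i < R" "j \<in> J" "circle_mult j (circle_mult (g ^ i) x) \<in> small_arc Q"
      by (auto simp: V_def A_def)
    have "circle_mult d x \<in> E" if "k \<in> K" "d * k = j" for d k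
    proof -
      have "circle_mult (g ^ i * k) (circle_mult d x) = circle_mult j (circle_mult (g ^ i) x)"
        using that(2) by (simp only: circle_mult_mult flip: that(2)) (simp only: ac_simps)
      then have "circle_mult d x \<in> circle_mult (g ^ i * k) -` small_arc Q" using ij(3) by simp
      then show ?thesis using ij(1) that(1) unfolding E_def by blast
    qed
    then show ?thesis using ij(2) by blast
  qed
  show ?thesis
    by (rule exI[of _ E], rule exI[of _ "- V"])
      (intro conjI ballI E mE mF hit borel_comp V(1), assumption)
qed

section \<open>From sweeping to divergence\<close>

lemma indicator_in_Lq_circle:
  assumes "G \<in> sets borel" and "q = \<infinity> \<or> q = 1"
  shows "(\<lambda>x. of_real (indicator G x)) \<in> Lq_circle q"
proof -
  have m: "(\<lambda>x. of_real (indicator G x) :: complex) \<in> borel_measurable haar"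
    using assms(1) by measurable
  have "AE x in haar. norm (of_real (indicator G x) :: complex) \<le> 1"
    by (auto simp: indicator_def)
  moreover have "integrable haar (\<lambda>x. norm (of_real (indicator G x) :: complex) powr 1)"
    by (rule haar.integrable_const_bound[of _ 1]) (use assms(1) in \<open>auto simp: indicator_def\<close>)
  ultimately show ?thesis using m assms(2) unfolding Lq_circle_def by auto
qed

lemma khintchin_indicator:
  assumes "khintchin q l" and "q = \<infinity> \<or> q = 1" and G: "G \<in> sets borel"
  shows "AE x in haar. (\<lambda>N. real (card {n\<in>{1..N}. circle_mult (l n) x \<in> G}) / real N)
    \<longlonglongrightarrow> measure haar G"
proof -
  let ?g = "\<lambda>x. of_real (indicator G x) :: complex"
  have int: "(LINT y|haar. ?g y) = of_real (measure haar G)"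
    using G by simp
  have "ergodic_avg l ?g N x = of_real (real (card {n\<in>{1..N}. circle_mult (l n) x \<in> G}) / real N)" for N x
  proof -
    have "(\<Sum>n=1..N. indicator G (circle_mult (l n) x)) = real (card {n\<in>{1..N}. circle_mult (l n) x \<in> G})"
      by (simp add: indicator_def sum.If_cases Int_def)
    then show ?thesis unfolding ergodic_avg_def of_real_sum[symmetric] by (simp only: of_real_divide of_real_of_nat_eq)
  qed
  moreover have "AE x in haar. (\<lambda>N. ergodic_avg l ?g N x) \<longlonglongrightarrow> (LINT y|haar. ?g y)"
    using assms(1) indicator_in_Lq_circle[OF G assms(2)] unfolding khintchin_def by blast
  ultimately show ?thesis unfolding int by (simp only: tendsto_of_real_iff)
qed

text \<open>
  The combinatorial core of the failure of pointwise convergence: a proportion \<open>c\<close> of the quotients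
  \<open>j / l n\<close> are integers in a set \<open>K\<close> that is arbitrarily small compared with the set \<open>J\<close> of all
  admissible \<open>j\<close>.  The bound \<open>M\<close> makes the visits happen at arbitrarily late times.
\<close>

definition sweeping :: "(nat \<Rightarrow> nat) \<Rightarrow> real \<Rightarrow> bool" where
  "sweeping l c \<longleftrightarrow> (\<forall>\<epsilon>>0. \<forall>M. \<exists>J K. finite J \<and> J \<noteq> {} \<and> 0 \<notin> J \<and> finite K \<and> 0 \<notin> K \<and>
      real (card K) \<le> \<epsilon> * real (card J) \<and>
      (\<forall>j\<in>J. \<exists>N\<ge>M. c * real N \<le> real (card {n\<in>{1..N}. \<exists>k\<in>K. l n * k = j})))"

text \<open>
  Towers for \<open>\<epsilon> = c \<cdot> 2\<^bsup>-M\<^esup>/16\<close> give sets \<open>E M\<close> whose union \<open>G\<close> has measure at most \<open>c/4\<close>, and sets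
  \<open>F M\<close> of measure at least \<open>1/2\<close> whose points visit \<open>E M\<close> with frequency at least \<open>c\<close> at some time
  after \<open>M\<close>.  The limit superior of the \<open>F M\<close> has measure at least \<open>1/2\<close>, and at its points the averages
  of the indicator of \<open>G\<close> cannot converge to the measure of \<open>G\<close>.
\<close>

theorem not_khintchin_if_sweeping:
  fixes l :: "nat \<Rightarrow> nat" and c :: real
  assumes c: "c > 0"
    and sweep: "sweeping l c"
    and q: "q = \<infinity> \<or> q = 1"
  shows "\<not> khintchin q l"
proof
  assume kh: "khintchin q l"
  define P where "P M E F \<longleftrightarrow> E \<in> sets borel \<and> F \<in> sets borel \<and>
      measure haar E \<le> c / 4 * (1/2) ^ Suc M \<and> measure haar F \<ge> 1/2 \<and>
      (\<forall>x\<in>F. \<exists>N\<ge>M. c * real N \<le> real (card {n\<in>{1..N}. circle_mult (l n) x \<in> E}))" for M E F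
  have "\<exists>E F. P M E F" for M
  proof -
    define \<epsilon> where "\<epsilon> = c / 8 * (1/2) ^ Suc M"
    have "\<epsilon> > 0" using c by (simp add: \<epsilon>_def)
    from sweep[unfolded sweeping_def, rule_format, OF this, of M] obtain J K where JK:
      "finite J" "J \<noteq> {}" "0 \<notin> J" "finite K" "0 \<notin> K" "real (card K) \<le> \<epsilon> * real (card J)" and
      hit: "\<And>j. j \<in> J \<Longrightarrow> \<exists>N\<ge>M. c * real N \<le> real (card {n\<in>{1..N}. \<exists>k\<in>K. l n * k = j})"
      by blast
    obtain E F where EF: "E \<in> sets borel" "F \<in> sets borel" "measure haar E \<le> 2 * \<epsilon>"
      "measure haar F \<ge> 1/2" "\<And>x. x \<in> F \<Longrightarrow> \<exists>j\<in>J. \<forall>d. \<forall>k\<in>K. d * k = j \<longrightarrow> circle_mult d x \<in> E"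
      using tower[OF JK] by blast
    have "\<exists>N\<ge>M. c * real N \<le> real (card {n\<in>{1..N}. circle_mult (l n) x \<in> E})" if "x \<in> F" for x
    proof -
      obtain j where j: "j \<in> J" "\<And>d k. k \<in> K \<Longrightarrow> d * k = j \<Longrightarrow> circle_mult d x \<in> E"
        using EF(5)[OF \<open>x \<in> F\<close>] by blast
      obtain N where N: "N \<ge> M" "c * real N \<le> real (card {n\<in>{1..N}. \<exists>k\<in>K. l n * k = j})"
        using hit[OF j(1)] by blast
      have "card {n\<in>{1..N}. \<exists>k\<in>K. l n * k = j} \<le> card {n\<in>{1..N}. circle_mult (l n) x \<in> E}"
        using j(2) by (intro card_mono) auto
      then show ?thesis using N by force
    qed
    then show ?thesis using EF(1-4) by (intro exI[of _ E] exI[of _ F]) (auto simp: P_def \<epsilon>_def)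
  qed
  then obtain E F where "\<And>M. P M (E M) (F M)" by metis
  then have EF: "\<And>M. E M \<in> sets borel" "\<And>M. F M \<in> sets borel"
    "\<And>M. measure haar (E M) \<le> c / 4 * (1/2) ^ Suc M" "\<And>M. measure haar (F M) \<ge> 1/2"
    "\<And>M x. x \<in> F M \<Longrightarrow> \<exists>N\<ge>M. c * real N \<le> real (card {n\<in>{1..N}. circle_mult (l n) x \<in> E M})"
    unfolding P_def by blast+
  define G where "G = (\<Union>M. E M)"
  have G: "G \<in> sets borel" using EF(1) by (auto simp: G_def)
  have mG: "measure haar G \<le> c / 4"
  proof -
    have geo: "(\<lambda>M. c / 4 * (1/2::real) ^ Suc M) sums (c / 4)"
      using sums_mult[OF power_half_series, of "c / 4"] by simp
    have sm: "summable (\<lambda>M. measure haar (E M))"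
      by (rule summable_comparison_test'[OF sums_summable[OF geo], of 0]) (use EF(3) in auto)
    have "measure haar G \<le> (\<Sum>M. measure haar (E M))"
      unfolding G_def using EF(1) sm by (intro haar.finite_measure_subadditive_countably) auto
    also have "\<dots> \<le> (\<Sum>M. c / 4 * (1/2) ^ Suc M)"
      using sm sums_summable[OF geo] EF(3) by (intro suminf_le) auto
    finally show ?thesis using sums_unique[OF geo] by simp
  qed
  define H where "H n = (\<Union>M\<in>{n..}. F M)" for n
  have H: "H n \<in> sets borel" for n using EF(2) by (auto simp: H_def)
  have mH: "measure haar (H n) \<ge> 1/2" for n
  proof -
    have "measure haar (F n) \<le> measure haar (H n)"
      using H[of n] by (intro haar.finite_measure_mono) (auto simp: H_def)
    then show ?thesis using EF(4)[of n] by simp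
  qed
  have "decseq H"
    unfolding decseq_def H_def by (intro allI impI UN_mono) auto
  then have "(\<lambda>n. measure haar (H n)) \<longlonglongrightarrow> measure haar (\<Inter>n. H n)"
    using H by (intro haar.finite_Lim_measure_decseq) auto
  then have "measure haar (\<Inter>n. H n) \<ge> 1/2"
    by (rule LIMSEQ_le_const) (use mH in auto)
  moreover have "AE x in haar. x \<notin> (\<Inter>n. H n)"
    using khintchin_indicator[OF kh q G]
  proof eventually_elim
    case (elim x)
    show ?case
    proof
      assume x: "x \<in> (\<Inter>n. H n)"
      have "\<forall>\<^sub>F N in sequentially. real (card {n\<in>{1..N}. circle_mult (l n) x \<in> G}) / real N < c"
        by (rule order_tendstoD(2)[OF elim]) (use mG c in linarith)
      then obtain M where M: "\<And>N. N \<ge> M \<Longrightarrow>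
          real (card {n\<in>{1..N}. circle_mult (l n) x \<in> G}) / real N < c"
        by (auto simp: eventually_sequentially)
      from x obtain M' where M': "M' \<ge> Suc M" "x \<in> F M'" by (auto simp: H_def)
      obtain N where N: "N \<ge> M'" "c * real N \<le> real (card {n\<in>{1..N}. circle_mult (l n) x \<in> E M'})"
        using EF(5)[OF M'(2)] by blast
      have "card {n\<in>{1..N}. circle_mult (l n) x \<in> E M'} \<le> card {n\<in>{1..N}. circle_mult (l n) x \<in> G}"
        by (intro card_mono) (auto simp: G_def)
      then have "c * real N \<le> real (card {n\<in>{1..N}. circle_mult (l n) x \<in> G})" using N(2) by linarith
      moreover have "real N > 0" using N(1) M'(1) by simp
      ultimately have "c \<le> real (card {n\<in>{1..N}. circle_mult (l n) x \<in> G}) / real N"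
        by (simp add: field_simps)
      then show False using M[of N] N(1) M'(1) by simp
    qed
  qed
  then have "measure haar (\<Inter>n. H n) = 0"
  proof -
    have "(\<Inter>n. H n) \<in> sets haar" using H by auto
    then have "(\<Inter>n. H n) \<in> null_sets haar"
      using \<open>AE x in haar. x \<notin> (\<Inter>n. H n)\<close> by (simp add: AE_iff_null_sets)
    then show ?thesis by (simp add: measure_def null_sets_def)
  qed
  ultimately show False by simp
qed

lemma not_khintchin_const:
  assumes "\<And>n. n \<ge> 1 \<Longrightarrow> l n = d" and q: "q = \<infinity> \<or> q = 1"
  shows "\<not> khintchin q l"
proof
  assume "khintchin q l"
  from khintchin_indicator[OF this q borel_small_arc[of 2]]
  have "AE x in haar. (\<lambda>N. real (card {n\<in>{1..N}. circle_mult (l n) x \<in> small_arc 2}) / real N) \<longlonglongrightarrow> 1/4"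
    by (simp add: measure_small_arc)
  then have "AE x in haar. False"
  proof eventually_elim
    case (elim x)
    let ?v = "of_bool (circle_mult d x \<in> small_arc 2) :: real"
    have "real (card {n\<in>{1..N}. circle_mult (l n) x \<in> small_arc 2}) / real N = ?v" if "N \<ge> 1" for N
    proof -
      have "{n\<in>{1..N}. circle_mult (l n) x \<in> small_arc 2} = (if circle_mult d x \<in> small_arc 2 then {1..N} else {})"
        using assms(1) by auto
      then show ?thesis using that by simp
    qed
    then have "\<forall>\<^sub>F N in sequentially. real (card {n\<in>{1..N}. circle_mult (l n) x \<in> small_arc 2}) / real N = ?v"
      by (rule eventually_sequentiallyI)
    from tendsto_eventually[OF this] have "1/4 = ?v" using elim LIMSEQ_unique by blast
    then show False by (cases "circle_mult d x \<in> small_arc 2") auto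
  qed
  then have "UNIV \<in> null_sets haar" using AE_iff_null_sets[of UNIV haar] by simp
  then show False using emeasure_haar_space by (simp add: null_sets_def)
qed

section \<open>Simultaneous approximation along lacunary sequences\<close>

text \<open>
  The condition on \<open>r\<close> at index \<open>i\<close> holds on an interval of length \<open>1/(4 |w i|)\<close> in each period of
  length \<open>1/|w i|\<close>.  Working down from the last index, where the intervals are longest, the ratio
  \<open>5\<close> is what makes an interval at index \<open>i + 1\<close> contain a whole interval at index \<open>i\<close>:
  a starting point within one period, plus the length, is \<open>1/|w i| + 1/(4 |w i|) \<le> 1/(4 |w (i+1)|)\<close>.
\<close>

lemma lacunary_interpolation:
  fixes w x :: "nat \<Rightarrow> real"
  assumes "\<And>i. i \<le> k \<Longrightarrow> w i \<noteq> 0"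
    and "\<And>i. i < k \<Longrightarrow> \<bar>w (Suc i)\<bar> \<le> \<bar>w i\<bar> / 5"
  shows "\<exists>r0. \<forall>r. r0 \<le> r \<longrightarrow> r \<le> r0 + 1 / (4 * \<bar>w 0\<bar>) \<longrightarrow>
    (\<forall>i\<le>k. \<exists>z::int. \<bar>r * w i - x i - of_int z\<bar> \<le> 1/8)"
  using assms
proof (induction k arbitrary: w x)
  \<comment> \<open>Every window of length 1/|w0| contains the start of a good interval for a single condition.\<close>
  have first: "\<exists>r0\<ge>A. r0 \<le> A + 1 / \<bar>w0\<bar> \<and> (\<forall>r. r0 \<le> r \<longrightarrow> r \<le> r0 + 1 / (4 * \<bar>w0\<bar>) \<longrightarrow>
      (\<exists>z::int. \<bar>r * w0 - x0 - of_int z\<bar> \<le> 1/8))" if "w0 \<noteq> 0" for A w0 x0 :: real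
  proof -
    define s where "s = sgn w0"
    have s: "\<bar>s\<bar> = 1" "w0 = s * \<bar>w0\<bar>" "s * s = 1"
      using that by (auto simp: s_def sgn_if)
    \<comment> \<open>the first integer target for which the good interval starts at or after A\<close>
    define z where "z = \<lceil>A * \<bar>w0\<bar> + 1/8 - s * x0\<rceil>"
    define r0 where "r0 = (s * x0 + of_int z - 1/8) / \<bar>w0\<bar>"
    have pos: "\<bar>w0\<bar> > 0" using that by simp
    have "A * \<bar>w0\<bar> \<le> s * x0 + of_int z - 1/8" unfolding z_def by linarith
    then have 1: "A \<le> r0" using pos by (simp add: r0_def field_simps)
    have "s * x0 + of_int z - 1/8 \<le> A * \<bar>w0\<bar> + 1" unfolding z_def by linarith
    then have "r0 \<le> (A * \<bar>w0\<bar> + 1) / \<bar>w0\<bar>"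
      unfolding r0_def using pos by (intro divide_right_mono) auto
    then have 2: "r0 \<le> A + 1 / \<bar>w0\<bar>" using pos by (simp add: add_divide_distrib)
    have "\<exists>z::int. \<bar>r * w0 - x0 - of_int z\<bar> \<le> 1/8" if r: "r0 \<le> r" "r \<le> r0 + 1 / (4 * \<bar>w0\<bar>)" for r
    proof -
      have "r0 * \<bar>w0\<bar> \<le> r * \<bar>w0\<bar>" "r * \<bar>w0\<bar> \<le> (r0 + 1 / (4 * \<bar>w0\<bar>)) * \<bar>w0\<bar>"
        using r pos by (auto intro!: mult_right_mono)
      moreover have "r0 * \<bar>w0\<bar> = s * x0 + of_int z - 1/8" using pos by (simp add: r0_def)
      moreover have "(r0 + 1 / (4 * \<bar>w0\<bar>)) * \<bar>w0\<bar> = r0 * \<bar>w0\<bar> + 1/4"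
        using pos by (simp add: distrib_right)
      ultimately have *: "\<bar>r * \<bar>w0\<bar> - s * x0 - of_int z\<bar> \<le> 1/8" by linarith
      have "r * w0 - x0 - s * of_int z = s * (r * \<bar>w0\<bar> - s * x0 - of_int z)"
      proof -
        have "s * (r * \<bar>w0\<bar> - s * x0 - of_int z) = r * (s * \<bar>w0\<bar>) - (s * s) * x0 - s * of_int z"
          by (simp add: algebra_simps)
        then show ?thesis using s by simp
      qed
      then have **: "\<bar>r * w0 - x0 - s * of_int z\<bar> \<le> 1/8" using * s(1) by (simp add: abs_mult)
      have "s = 1 \<or> s = -1" using s(1) by linarith
      then have "s * of_int z = of_int z \<or> s * of_int z = of_int (- z)" by auto
      then show ?thesis using ** by metis
    qed
    then show ?thesis using 1 2 by blast
  qed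
  {
    case 0
    then show ?case using first[of "w 0" 0 "x 0"] by auto
  next
    case (Suc k)
    obtain A where A: "\<And>r i. A \<le> r \<Longrightarrow> r \<le> A + 1 / (4 * \<bar>w 1\<bar>) \<Longrightarrow> i \<le> k \<Longrightarrow>
        \<exists>z::int. \<bar>r * w (Suc i) - x (Suc i) - of_int z\<bar> \<le> 1/8"
    proof -
      have "\<exists>r0. \<forall>r. r0 \<le> r \<longrightarrow> r \<le> r0 + 1 / (4 * \<bar>w (Suc 0)\<bar>) \<longrightarrow>
          (\<forall>i\<le>k. \<exists>z::int. \<bar>r * w (Suc i) - x (Suc i) - of_int z\<bar> \<le> 1/8)"
        by (rule Suc.IH) (use Suc.prems in auto)
      then show ?thesis using that by (metis One_nat_def)
    qed
    have w0: "w 0 \<noteq> 0" and w1: "w 1 \<noteq> 0" using Suc.prems(1)[of 0] Suc.prems(1)[of 1] by auto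
    obtain r0 where r0: "A \<le> r0" "r0 \<le> A + 1 / \<bar>w 0\<bar>"
      "\<And>r. r0 \<le> r \<Longrightarrow> r \<le> r0 + 1 / (4 * \<bar>w 0\<bar>) \<Longrightarrow>
        \<exists>z::int. \<bar>r * w 0 - x 0 - of_int z\<bar> \<le> 1/8"
      using first[OF w0, of A "x 0"] by blast
    have "4 * \<bar>w 1\<bar> \<le> \<bar>w 0\<bar> * (4/5)" using Suc.prems(2)[of 0] by simp
    then have "1 / (\<bar>w 0\<bar> * (4/5)) \<le> 1 / (4 * \<bar>w 1\<bar>)" using w1 by (intro divide_left_mono) auto
    moreover have "1 / \<bar>w 0\<bar> + 1 / (4 * \<bar>w 0\<bar>) = 1 / (\<bar>w 0\<bar> * (4/5))"
      using w0 by (simp add: field_simps)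
    ultimately have le: "1 / \<bar>w 0\<bar> + 1 / (4 * \<bar>w 0\<bar>) \<le> 1 / (4 * \<bar>w 1\<bar>)" by simp
    have "\<exists>z::int. \<bar>r * w i - x i - of_int z\<bar> \<le> 1/8"
      if "r0 \<le> r" "r \<le> r0 + 1 / (4 * \<bar>w 0\<bar>)" "i \<le> Suc k" for r i
    proof (cases i)
      case 0
      then show ?thesis using r0(3) that by blast
    next
      case (Suc j)
      then show ?thesis using A[of r j] that r0(1,2) le by simp
    qed
    then show ?case by blast
  }
qed

text \<open>
  When \<open>|w 0| \<le> 1/4\<close>, the interval of good real numbers has length at least \<open>1\<close>.
\<close>

lemma lacunary_interpolation_int:
  fixes w x :: "nat \<Rightarrow> real"
  assumes "\<And>i. i \<le> k \<Longrightarrow> w i \<noteq> 0"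
    and "\<And>i. i < k \<Longrightarrow> \<bar>w (Suc i)\<bar> \<le> \<bar>w i\<bar> / 5"
    and "\<bar>w 0\<bar> \<le> 1/4"
  shows "\<exists>r::int. \<forall>i\<le>k. \<exists>z::int. \<bar>of_int r * w i - x i - of_int z\<bar> \<le> 1/8"
proof -
  obtain r0 where r0: "\<And>r i. r0 \<le> r \<Longrightarrow> r \<le> r0 + 1 / (4 * \<bar>w 0\<bar>) \<Longrightarrow> i \<le> k \<Longrightarrow>
      \<exists>z::int. \<bar>r * w i - x i - of_int z\<bar> \<le> 1/8"
    using lacunary_interpolation[of k w x, OF assms(1,2)] by blast
  have "1 \<le> 1 / (4 * \<bar>w 0\<bar>)" using assms(1)[of 0] assms(3) by (simp add: field_simps)
  then have "r0 \<le> of_int \<lceil>r0\<rceil>" "of_int \<lceil>r0\<rceil> \<le> r0 + 1 / (4 * \<bar>w 0\<bar>)" by linarith+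
  then show ?thesis using r0 by blast
qed

section \<open>Avoiding quarters of the circle\<close>

text \<open>
  The index of the quarter \<open>[q/4, (q+1)/4)\<close> of the circle in which a number lies modulo \<open>1\<close>.
\<close>

definition quarter :: "real \<Rightarrow> int" where
  "quarter y = \<lfloor>4 * y\<rfloor> mod 4"

lemma quarter_in: "quarter y \<in> {0..<4}"
  by (simp add: quarter_def)

lemma quarter_add_int: "quarter (y + of_int z) = quarter y"
proof -
  have "4 * (y + of_int z) = 4 * y + of_int (4 * z)" by simp
  then have "\<lfloor>4 * (y + of_int z)\<rfloor> = \<lfloor>4 * y\<rfloor> + 4 * z" by (metis floor_add_int)
  then show ?thesis by (simp add: quarter_def)
qed

text \<open>
  A quarter, enlarged by \<open>1/8\<close> on either side, is a half-open half circle.  Exactly one of the two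
  antipodal points \<open>u\<close> and \<open>u - 1/2\<close> lies in it, and the shift is chosen to use the other one.
\<close>

lemma avoid_quarter:
  fixes u :: real
  shows "\<exists>b::bool. \<forall>y. (\<exists>z::int. \<bar>y - (if b then 1/2 else 0) - of_int z\<bar> \<le> 1/8)
    \<longrightarrow> quarter (u - y) \<noteq> q"
proof (rule ccontr)
  assume "\<not> ?thesis"
  then have *: "\<exists>y z. \<bar>y - (if b then 1/2 else 0) - of_int z\<bar> \<le> 1/8 \<and> quarter (u - y) = q" for b
    by blast
  obtain y z where y: "\<bar>y - 1/2 - of_int z\<bar> \<le> 1/8" "quarter (u - y) = q"
    using *[of True] by auto
  obtain y' z' where y': "\<bar>y' - of_int z'\<bar> \<le> 1/8" "quarter (u - y') = q"
    using *[of False] by auto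
  define A where "A = \<lfloor>4 * (u - y)\<rfloor>"
  define A' where "A' = \<lfloor>4 * (u - y')\<rfloor>"
  have "A mod 4 = A' mod 4" using y(2) y'(2) by (simp add: quarter_def A_def A'_def)
  then obtain d where d: "A' = A + 4 * d" by (metis mod_eqE mult.commute)
  have *: "real_of_int A' = real_of_int A + 4 * real_of_int d" by (simp add: d)
  have "real_of_int A \<le> 4 * (u - y)" "4 * (u - y) < real_of_int A + 1"
       "real_of_int A' \<le> 4 * (u - y')" "4 * (u - y') < real_of_int A' + 1"
    unfolding A_def A'_def by linarith+
  then have "\<bar>4 * (y - y') - 4 * real_of_int d\<bar> < 1"
    unfolding * abs_less_iff by argo
  moreover have "\<bar>4 * (y - y') - 2 - 4 * real_of_int (z - z')\<bar> \<le> 1" using y(1) y'(1)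
    unfolding of_int_diff by argo
  ultimately have "\<bar>2 + 4 * real_of_int (z - z') - 4 * real_of_int d\<bar> < 2" by linarith
  then have "\<bar>2 + 4 * (z - z') - 4 * d\<bar> < 2" by linarith
  then show False by presburger
qed

text \<open>
  One coordinate after the other, the most popular of the four values is discarded; it accounts for at
  least a quarter of what is left.
\<close>

lemma pigeonhole_avoid:
  fixes g :: "nat \<Rightarrow> 'a \<Rightarrow> int"
  assumes "finite K" and g: "\<And>i k. g i k \<in> {0..<4}"
  shows "\<exists>q. real (card {k\<in>K. \<forall>i<m. g i k \<noteq> q i}) \<le> (3/4) ^ m * real (card K)"
proof (induction m)
  case 0
  then show ?case by simp
next
  case (Suc m)
  then obtain q where q: "real (card {k\<in>K. \<forall>i<m. g i k \<noteq> q i}) \<le> (3/4) ^ m * real (card K)"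
    by blast
  define K' where "K' = {k\<in>K. \<forall>i<m. g i k \<noteq> q i}"
  have fin: "finite K'" using assms(1) by (simp add: K'_def)
  have "card K' = (\<Sum>c\<in>{0..<4}. card {k\<in>K'. g m k = c})"
    using card_eq_sum[of K'] sum.group[of K' "{0..<4::int}" "g m" "\<lambda>_. 1::nat"] fin g
    by (auto simp: image_subset_iff)
  have "\<exists>c\<in>{0..<4}. card K' \<le> 4 * card {k\<in>K'. g m k = c}"
  proof (rule ccontr)
    assume "\<not> ?thesis"
    then have "(\<Sum>c\<in>{0..<4::int}. 4 * card {k\<in>K'. g m k = c}) < (\<Sum>c\<in>{0..<4::int}. card K')"
      by (intro sum_strict_mono) (auto simp: not_le)
    then show False using \<open>card K' = _\<close> by (simp add: sum_distrib_left[symmetric])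
  qed
  then obtain c where c: "card K' \<le> 4 * card {k\<in>K'. g m k = c}" by blast
  have "card K' = card {k\<in>K'. g m k = c} + card {k\<in>K'. g m k \<noteq> c}"
    using fin by (subst card_Un_disjoint[symmetric]) (auto intro: arg_cong[of _ _ card])
  with c have "real (card {k\<in>K'. g m k \<noteq> c}) \<le> 3/4 * real (card K')" by linarith
  also have "\<dots> \<le> 3/4 * ((3/4) ^ m * real (card K))" using q by (simp add: K'_def)
  also have "{k\<in>K'. g m k \<noteq> c} = {k\<in>K. \<forall>i<Suc m. g i k \<noteq> (q(m := c)) i}"
    by (auto simp: K'_def less_Suc_eq)
  finally have "real (card {k\<in>K. \<forall>i<Suc m. g i k \<noteq> (q(m := c)) i}) \<le> (3/4) ^ Suc m * real (card K)"
    by simp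
  then show ?case by blast
qed

section \<open>Boxes of monomials\<close>

text \<open>
  Monomials in the elements of \<open>A\<close> with exponents at most \<open>t\<close>: the Foelner sets of the multiplicative
  semigroup generated by \<open>A\<close>.
\<close>

definition monomial_box :: "nat set \<Rightarrow> nat \<Rightarrow> nat set" where
  "monomial_box A t = (\<lambda>e. \<Prod>d\<in>A. d ^ e d) ` (A \<rightarrow>\<^sub>E {..t})"

lemma finite_monomial_box: "finite A \<Longrightarrow> finite (monomial_box A t)"
  by (auto simp: monomial_box_def intro!: finite_PiE)

lemma card_monomial_box: "finite A \<Longrightarrow> card (monomial_box A t) \<le> Suc t ^ card A"
  unfolding monomial_box_def
  by (rule card_image_le[THEN order_trans]) (auto simp: card_PiE intro!: finite_PiE)

lemma monomial_box_pos: "0 \<notin> A \<Longrightarrow> 0 \<notin> monomial_box A t"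
  by (cases "finite A") (auto simp: monomial_box_def)

lemma one_in_monomial_box: "1 \<in> monomial_box A t"
  unfolding monomial_box_def by (rule image_eqI[where x = "\<lambda>d\<in>A. 0"]) auto

lemma monomial_box_divide:
  assumes "finite A" "d \<in> A" "k \<in> monomial_box A t"
  shows "\<exists>k'\<in>monomial_box A (Suc t). d * k' = \<Prod>A * k"
proof -
  obtain e where e: "e \<in> A \<rightarrow>\<^sub>E {..t}" "k = (\<Prod>d\<in>A. d ^ e d)"
    using assms(3) by (auto simp: monomial_box_def)
  define e' where "e' = (\<lambda>d'\<in>A. if d' = d then e d' else Suc (e d'))"
  have "e' \<in> A \<rightarrow>\<^sub>E {..Suc t}" using e(1) by (auto simp: e'_def PiE_iff le_SucI)
  then have "(\<Prod>x\<in>A. x ^ e' x) \<in> monomial_box A (Suc t)" unfolding monomial_box_def by blast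
  moreover have "d * (\<Prod>x\<in>A. x ^ e' x) = \<Prod>A * k"
  proof -
    have "(\<Prod>x\<in>A. x ^ e' x) = d ^ e d * (\<Prod>x\<in>A - {d}. x * x ^ e x)"
      using assms(1,2) by (subst prod.remove[of _ d]) (auto simp: e'_def intro!: prod.cong)
    moreover have "\<Prod>A * k = (\<Prod>x\<in>A. x * x ^ e x)" by (simp add: e(2) prod.distrib)
    moreover have "\<dots> = d * d ^ e d * (\<Prod>x\<in>A - {d}. x * x ^ e x)"
      using assms(1,2) by (subst prod.remove[of _ d]) auto
    ultimately show ?thesis by (simp add: mult.assoc)
  qed
  ultimately show ?thesis by blast
qed

text \<open>
  The sizes grow at most polynomially in \<open>t\<close>, so they cannot more than double at each step.
\<close>

lemma monomial_box_growth:
  assumes "finite A"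
  shows "\<exists>t. card (monomial_box A (Suc t)) \<le> 2 * card (monomial_box A t)"
proof (rule ccontr)
  assume "\<not> ?thesis"
  then have step: "2 * card (monomial_box A t) < card (monomial_box A (Suc t))" for t by (simp add: not_le)
  have "2 ^ t \<le> card (monomial_box A t)" for t
  proof (induction t)
    case 0
    have "card (monomial_box A 0) \<noteq> 0" using one_in_monomial_box[of A 0] finite_monomial_box[OF assms] by auto
    then show ?case by simp
  next
    case (Suc t)
    then show ?case using step[of t] by simp
  qed
  then have "2 ^ t \<le> Suc t ^ card A" for t using card_monomial_box[OF assms, of t] le_trans by blast
  then have *: "(2::real) ^ t \<le> real (Suc t) ^ card A" for t
    by (metis of_nat_le_iff of_nat_numeral of_nat_power)
  have "filterlim (\<lambda>t. real (Suc t) * ln 2) at_top sequentially"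
    by (intro filterlim_at_top_mult_tendsto_pos[OF tendsto_const] filterlim_compose[OF
        filterlim_real_sequentially filterlim_Suc]) simp
  from filterlim_compose[OF tendsto_power_div_exp_0 this]
  have "((\<lambda>t. (real (Suc t) * ln 2) ^ card A / exp (real (Suc t) * ln 2)) \<longlongrightarrow> 0) sequentially" .
  moreover have "exp (real (Suc t) * ln 2) = 2 ^ Suc t" for t
    by (simp only: exp_of_nat_mult exp_ln zero_less_numeral)
  ultimately have "((\<lambda>t. (real (Suc t) * ln 2) ^ card A / 2 ^ Suc t) \<longlongrightarrow> 0) sequentially" by simp
  then have "eventually (\<lambda>t. (real (Suc t) * ln 2) ^ card A / 2 ^ Suc t < ln 2 ^ card A / 2) sequentially"
    by (rule order_tendstoD) simp
  then obtain t where "(real (Suc t) * ln 2) ^ card A / 2 ^ Suc t < ln 2 ^ card A / 2"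
    by (auto simp: eventually_sequentially)
  then have "real (Suc t) ^ card A < 2 ^ t"
    by (simp add: power_mult_distrib field_simps del: of_nat_Suc)
  then show False using *[of t] by simp
qed

section \<open>Lacunary perturbations are sweeping\<close>

text \<open>
  The dyadic block of multiples of \<open>L\<close> makes up the fraction \<open>1/(2L)\<close> of all indices up to its end.
\<close>

lemma block_hits:
  fixes L M k :: nat
  assumes "L > 0"
    and "\<And>i. 2 ^ (k + s) \<le> i \<Longrightarrow> i < 2 ^ Suc (k + s) \<Longrightarrow> P (L * i)"
  shows "1 / real (2 * L) * real (L * 2 ^ Suc (k + s)) \<le> real (card {n\<in>{1..L * 2 ^ Suc (k + s)}. P n})"
proof -
  have "(\<lambda>i. L * i) ` {2 ^ (k + s)..<2 ^ Suc (k + s)} \<subseteq> {n\<in>{1..L * 2 ^ Suc (k + s)}. P n}"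
  proof
    fix n assume "n \<in> (\<lambda>i. L * i) ` {2 ^ (k + s)..<2 ^ Suc (k + s)}"
    then obtain i where i: "n = L * i" "2 ^ (k + s) \<le> i" "i < 2 ^ Suc (k + s)"
      by (elim imageE) (simp only: atLeastLessThan_iff)
    have "0 < i" using i(2) by (rule order.strict_trans2[rotated]) simp
    then have "1 \<le> L * i" using assms(1) by (simp add: Suc_le_eq)
    moreover have "L * i \<le> L * 2 ^ Suc (k + s)" using i(3) by (intro mult_left_mono) auto
    moreover have "P (L * i)" by (rule assms(2)[OF i(2,3)])
    ultimately show "n \<in> {n\<in>{1..L * 2 ^ Suc (k + s)}. P n}" unfolding i(1) by simp
  qed
  then have "card ((\<lambda>i. L * i) ` {2 ^ (k + s)..<2 ^ Suc (k + s)}) \<le> card {n\<in>{1..L * 2 ^ Suc (k + s)}. P n}"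
    by (intro card_mono) auto
  moreover have "card ((\<lambda>i. L * i) ` {2 ^ (k + s)..<2 ^ Suc (k + s)}) = 2 ^ (k + s)"
    using assms(1) by (subst card_image) (auto simp: inj_on_def)
  ultimately have "2 ^ (k + s) \<le> card {n\<in>{1..L * 2 ^ Suc (k + s)}. P n}" by simp
  moreover have "1 / real (2 * L) * real (L * 2 ^ Suc (k + s)) = real (2 ^ (k + s))"
    using assms(1) by simp
  ultimately show ?thesis by (simp only: of_nat_le_iff)
qed

text \<open>
  The patterns in \<open>{0, 1/2}\<^sup>m\<close> are subsets \<open>D\<close> of \<open>{..<m}\<close>, and \<open>D\<close> is prescribed on the dyadic block whose
  number is the binary code of \<open>D\<close>.  Multiplying a monomial box by the product of all generators
  makes each of its elements \<open>j\<close> divisible by each \<open>l n\<close>; for a box of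
  suitable size, the quotients \<open>j / l n\<close> then lie in a box with at most twice as many elements.
\<close>

lemma dyadic_pattern_sweeping:
  fixes l :: "nat \<Rightarrow> nat" and w :: "nat \<Rightarrow> real" and e :: "nat \<Rightarrow> int" and \<alpha> :: real
  assumes L: "L > 0" and pos: "\<And>n. n \<ge> 1 \<Longrightarrow> l n > 0"
    and log: "\<And>n. n \<ge> 1 \<Longrightarrow> ln (real (l n)) = \<alpha> * (of_int (e n) + w n)" and \<alpha>: "\<alpha> > 0"
    and lac: "\<And>i. i \<ge> start \<Longrightarrow> w (L * i) \<noteq> 0"
      "\<And>i. i \<ge> start \<Longrightarrow> \<bar>w (L * Suc i)\<bar> \<le> \<bar>w (L * i)\<bar> / 5"
      "\<And>i. i \<ge> start \<Longrightarrow> \<bar>w (L * i)\<bar> \<le> 1/4"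
    and \<epsilon>: "\<epsilon> > 0"
  shows "\<exists>J K. finite J \<and> J \<noteq> {} \<and> 0 \<notin> J \<and> finite K \<and> 0 \<notin> K \<and>
      real (card K) \<le> \<epsilon> * real (card J) \<and>
      (\<forall>j\<in>J. \<exists>N\<ge>M. 1 / real (2 * L) * real N \<le> real (card {n\<in>{1..N}. \<exists>k\<in>K. l n * k = j}))"
proof -
  obtain m where m: "(3/4::real) ^ m < \<epsilon> / 2"
    using real_arch_pow_inv[of "\<epsilon> / 2" "3/4::real"] \<epsilon> by auto
  define s where "s = max start M"
  have s: "start \<le> 2 ^ (k + s)" "M \<le> 2 ^ (k + s)" for k
    using less_exp[of "k + s"] unfolding s_def by linarith+
  define k0 where "k0 = Max (set_encode ` Pow {..<m})"
  have k0: "set_encode D \<le> k0" if "D \<subseteq> {..<m}" for D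
    unfolding k0_def using that by (intro Max_ge) auto
  define N0 where "N0 = L * 2 ^ Suc (k0 + s)"
  \<comment> \<open>the target for the character c at the index L * i, read off from the number of the block of i\<close>
  define x where "x c i = (if c \<in> set_decode (floor_log i - s) then 1/2 else 0 :: real)" for c i
  have "\<exists>r::int. \<forall>i. 2 ^ s \<le> i \<longrightarrow> i \<le> 2 ^ Suc (k0 + s) \<longrightarrow>
      (\<exists>z::int. \<bar>of_int r * w (L * i) - x c i - of_int z\<bar> \<le> 1/8)" for c
  proof -
    have "\<exists>r::int. \<forall>i\<le>2 ^ Suc (k0 + s). \<exists>z::int.
        \<bar>of_int r * w (L * (2 ^ s + i)) - x c (2 ^ s + i) - of_int z\<bar> \<le> 1/8"
      by (rule lacunary_interpolation_int) (use lac s[of 0] in auto)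
    then obtain r :: int where r: "\<And>i. i \<le> 2 ^ Suc (k0 + s) \<Longrightarrow> \<exists>z::int.
        \<bar>of_int r * w (L * (2 ^ s + i)) - x c (2 ^ s + i) - of_int z\<bar> \<le> 1/8"
      by blast
    have "\<exists>z::int. \<bar>of_int r * w (L * i) - x c i - of_int z\<bar> \<le> 1/8"
      if "2 ^ s \<le> i" "i \<le> 2 ^ Suc (k0 + s)" for i
      using r[of "i - 2 ^ s"] that by simp
    then show ?thesis by blast
  qed
  then obtain r :: "nat \<Rightarrow> int" where r: "\<And>c i. 2 ^ s \<le> i \<Longrightarrow> i \<le> 2 ^ Suc (k0 + s) \<Longrightarrow>
      \<exists>z::int. \<bar>of_int (r c) * w (L * i) - x c i - of_int z\<bar> \<le> 1/8"
    by metis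
  \<comment> \<open>lifts to the reals of the characters; modulo 1 they vanish at exp \<alpha>\<close>
  define \<phi> where "\<phi> c k = of_int (r c) * (ln (real k) / \<alpha>)" for c and k :: nat
  define A where "A = l ` {1..N0}"
  have A: "finite A" "0 \<notin> A"
    using pos by (force simp: A_def)+
  obtain t where t: "card (monomial_box A (Suc t)) \<le> 2 * card (monomial_box A t)"
    using monomial_box_growth[OF A(1)] by blast
  define J where "J = (\<lambda>k. \<Prod>A * k) ` monomial_box A t"
  have PA: "\<Prod>A > 0" using A by (auto intro!: Nat.gr0I)
  have J: "finite J" "J \<noteq> {}" "0 \<notin> J"
    using PA finite_monomial_box[OF A(1)] one_in_monomial_box[of A t] monomial_box_pos[OF A(2)]
    by (auto simp: J_def)
  have cardJ: "card J = card (monomial_box A t)"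
    unfolding J_def using PA by (intro card_image) (auto simp: inj_on_def)
  obtain q where q: "real (card {k\<in>monomial_box A (Suc t). \<forall>c<m. quarter (\<phi> c k) \<noteq> q c})
      \<le> (3/4) ^ m * real (card (monomial_box A (Suc t)))"
    using pigeonhole_avoid[OF finite_monomial_box[OF A(1)], of "\<lambda>c k. quarter (\<phi> c k)" "Suc t" m]
      quarter_in by blast
  define K where "K = {k\<in>monomial_box A (Suc t). \<forall>c<m. quarter (\<phi> c k) \<noteq> q c}"
  have K: "finite K" "0 \<notin> K"
    using finite_monomial_box[OF A(1)] monomial_box_pos[OF A(2)] by (auto simp: K_def)
  have "real (card K) \<le> (3/4) ^ m * real (card (monomial_box A (Suc t)))"
    using q by (simp add: K_def)
  also have "\<dots> \<le> (\<epsilon> / 2) * real (2 * card (monomial_box A t))"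
    using m t \<epsilon> by (intro mult_mono of_nat_mono) auto
  finally have cardK: "real (card K) \<le> \<epsilon> * real (card J)" by (simp add: cardJ)
  have "\<exists>N\<ge>M. 1 / real (2 * L) * real N \<le> real (card {n\<in>{1..N}. \<exists>k\<in>K. l n * k = j})"
    if "j \<in> J" for j
  proof -
    obtain k' where k': "k' \<in> monomial_box A t" "j = \<Prod>A * k'" using \<open>j \<in> J\<close> by (auto simp: J_def)
    have "\<exists>b::bool. \<forall>y. (\<exists>z::int. \<bar>y - (if b then 1/2 else 0) - of_int z\<bar> \<le> 1/8)
        \<longrightarrow> quarter (\<phi> c j - y) \<noteq> q c" for c
      by (rule avoid_quarter)
    then obtain b :: "nat \<Rightarrow> bool" where b: "\<And>c y z. \<bar>y - (if b c then 1/2 else 0) - of_int z\<bar> \<le> 1/8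
        \<Longrightarrow> quarter (\<phi> c j - y) \<noteq> q c"
      by metis
    \<comment> \<open>the pattern that moves all character values of j out of the forbidden quarters\<close>
    define D where "D = {c. c < m \<and> b c}"
    define k where "k = set_encode D"
    have D: "D \<subseteq> {..<m}" "finite D" by (auto simp: D_def)
    have kk0: "k \<le> k0" using k0[OF D(1)] by (simp add: k_def)
    have hit: "\<exists>k\<in>K. l (L * i) * k = j" if i: "2 ^ (k + s) \<le> i" "i < 2 ^ Suc (k + s)" for i
    proof -
      have ip: "i > 0" using i(1) by (rule order.strict_trans2[rotated]) simp
      have up: "(2::nat) ^ Suc (k + s) \<le> 2 ^ Suc (k0 + s)"
        using kk0 by (intro power_increasing) auto
      have n1: "L * i \<ge> 1" using L ip by (simp add: Suc_le_eq)
      have "L * i \<le> N0" unfolding N0_def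
        by (intro mult_left_mono order_trans[OF less_imp_le[OF i(2)] up]) simp
      then have "l (L * i) \<in> A" using n1 by (auto simp: A_def)
      from monomial_box_divide[OF A(1) this k'(1)]
      obtain k1 where k1: "k1 \<in> monomial_box A (Suc t)" "l (L * i) * k1 = j"
        using k'(2) by blast
      have "floor_log i = k + s"
        using i ip by (intro floor_log_eqI) auto
      then have xD: "x c i = (if b c then 1/2 else 0)" if "c < m" for c
        using that D(2) by (simp add: x_def k_def D_def set_encode_inverse)
      have "quarter (\<phi> c k1) \<noteq> q c" if "c < m" for c
      proof -
        have "(2::nat) ^ s \<le> 2 ^ (k + s)" by (intro power_increasing) auto
        from order_trans[OF this i(1)] order_trans[OF less_imp_le[OF i(2)] up]
        have "2 ^ s \<le> i" "i \<le> 2 ^ Suc (k0 + s)" .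
        then obtain z :: int where "\<bar>of_int (r c) * w (L * i) - x c i - of_int z\<bar> \<le> 1/8"
          using r[of i c] by blast
        then have *: "quarter (\<phi> c j - of_int (r c) * w (L * i)) \<noteq> q c"
          using b[of "of_int (r c) * w (L * i)" c z] xD[OF that] by simp
        have "k1 > 0" using k1(1) monomial_box_pos[OF A(2)] by (metis gr0I)
        then have "ln (real j) = ln (real (l (L * i))) + ln (real k1)"
          using k1(2) pos[OF n1] by (simp add: ln_mult flip: k1(2))
        then have "ln (real j) / \<alpha> = of_int (e (L * i)) + w (L * i) + ln (real k1) / \<alpha>"
          using log[OF n1] \<alpha> by (simp add: add_divide_distrib)
        then have "\<phi> c j - of_int (r c) * w (L * i) = \<phi> c k1 + of_int (r c * e (L * i))"
          by (simp add: \<phi>_def algebra_simps)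
        then show ?thesis using * quarter_add_int by metis
      qed
      then have "k1 \<in> K" using k1(1) by (simp add: K_def)
      then show ?thesis using k1(2) by blast
    qed
    have "M \<le> L * 2 ^ Suc (k + s)"
    proof -
      have "M \<le> 2 ^ (k + s)" by (rule s)
      also have "\<dots> \<le> L * 2 ^ Suc (k + s)" using L by simp
      finally show ?thesis .
    qed
    moreover have "1 / real (2 * L) * real (L * 2 ^ Suc (k + s))
        \<le> real (card {n\<in>{1..L * 2 ^ Suc (k + s)}. \<exists>k\<in>K. l n * k = j})"
      by (rule block_hits[OF L]) (rule hit)
    ultimately show ?thesis by blast
  qed
  then show ?thesis using J K cardK by blast
qed

text \<open>
  Passing to the multiples of a fixed \<open>L\<close> with \<open>\<rho>\<^sup>L \<le> 1/5\<close> only costs a constant proportion of the indices,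
  which does not depend on \<open>\<epsilon>\<close>.
\<close>

lemma lacunary_sweeping:
  fixes l :: "nat \<Rightarrow> nat" and \<theta> :: "nat \<Rightarrow> real" and e :: "nat \<Rightarrow> int" and \<alpha> \<rho> :: real
  assumes pos: "\<And>n. n \<ge> 1 \<Longrightarrow> l n > 0"
    and log: "\<And>n. n \<ge> 1 \<Longrightarrow> ln (real (l n)) = \<alpha> * of_int (e n) + \<theta> n" and \<alpha>: "\<alpha> > 0"
    and \<rho>: "0 < \<rho>" "\<rho> < 1"
    and lac: "\<And>n. n \<ge> start \<Longrightarrow> 0 < \<bar>\<theta> (Suc n)\<bar> \<and> \<bar>\<theta> (Suc n)\<bar> \<le> \<rho> * \<bar>\<theta> n\<bar>"
  shows "\<exists>c>0. sweeping l c"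
proof -
  have decay: "\<bar>\<theta> (n + d)\<bar> \<le> \<rho> ^ d * \<bar>\<theta> n\<bar>" if "n \<ge> start" for n d
  proof (induction d)
    case (Suc d)
    have "\<bar>\<theta> (n + Suc d)\<bar> \<le> \<rho> * \<bar>\<theta> (n + d)\<bar>" using lac[of "n + d"] that by simp
    also have "\<dots> \<le> \<rho> * (\<rho> ^ d * \<bar>\<theta> n\<bar>)" using Suc \<rho> by (intro mult_left_mono) auto
    finally show ?case by simp
  qed simp
  obtain L0 where "\<rho> ^ L0 < 1/5" using real_arch_pow_inv[of "1/5" \<rho>] \<rho> by auto
  define L where "L = Suc L0"
  have L: "L > 0" "\<rho> ^ L \<le> 1/5"
  proof -
    have "\<rho> ^ L \<le> \<rho> ^ L0" unfolding L_def using \<rho> by (intro power_decreasing) auto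
    then show "\<rho> ^ L \<le> 1/5" using \<open>\<rho> ^ L0 < 1/5\<close> by simp
  qed (simp add: L_def)
  define w where "w n = \<theta> n / \<alpha>" for n
  have "(\<lambda>d. \<rho> ^ d * \<bar>\<theta> start\<bar>) \<longlonglongrightarrow> 0"
    using \<rho> by (intro tendsto_mult_left_zero LIMSEQ_realpow_zero) auto
  then have "\<forall>\<^sub>F d in sequentially. \<rho> ^ d * \<bar>\<theta> start\<bar> < \<alpha> / 4"
    by (rule order_tendstoD) (use \<alpha> in simp)
  then obtain d0 where d0: "\<And>d. d \<ge> d0 \<Longrightarrow> \<rho> ^ d * \<bar>\<theta> start\<bar> < \<alpha> / 4"
    by (auto simp: eventually_sequentially)
  define i0 where "i0 = Suc start + d0"
  have idx: "L * i \<ge> i" for i using L(1) by (cases L) auto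
  have small: "\<bar>w (L * i)\<bar> \<le> 1/4" if "i \<ge> i0" for i
  proof -
    have le: "start + d0 \<le> L * i" using that idx[of i] unfolding i0_def by linarith
    have "\<bar>\<theta> (L * i)\<bar> \<le> \<rho> ^ (L * i - start) * \<bar>\<theta> start\<bar>"
      using decay[of start "L * i - start"] le by simp
    also have "\<dots> \<le> \<alpha> / 4" by (rule less_imp_le[OF d0]) (use le in linarith)
    finally show ?thesis using \<alpha> by (simp add: w_def field_simps)
  qed
  have ratio: "\<bar>w (L * Suc i)\<bar> \<le> \<bar>w (L * i)\<bar> / 5" if "i \<ge> i0" for i
  proof -
    have "\<bar>\<theta> (L * i + L)\<bar> \<le> \<rho> ^ L * \<bar>\<theta> (L * i)\<bar>"
      by (rule decay) (use that idx[of i] in \<open>unfold i0_def, linarith\<close>)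
    also have "\<dots> \<le> 1/5 * \<bar>\<theta> (L * i)\<bar>" using L(2) by (intro mult_right_mono) auto
    finally show ?thesis using \<alpha> by (simp add: w_def field_simps add.commute)
  qed
  have nz: "w (L * i) \<noteq> 0" if "i \<ge> i0" for i
  proof -
    obtain n where "L * i = Suc n" "n \<ge> start"
    proof -
      have "L * i = Suc (L * i - 1)" "L * i - 1 \<ge> start"
        using \<open>i \<ge> i0\<close> idx[of i] unfolding i0_def by linarith+
      then show ?thesis by (rule that)
    qed
    then show ?thesis using lac[of n] \<alpha> by (auto simp: w_def)
  qed
  have log': "ln (real (l n)) = \<alpha> * (of_int (e n) + w n)" if "n \<ge> 1" for n
    using log[OF that] \<alpha> by (simp add: w_def distrib_left)
  show ?thesis
    unfolding sweeping_def
  proof (intro exI[of _ "1 / real (2 * L)"] conjI allI impI)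
    show "1 / real (2 * L) > 0" using L(1) by simp
  qed (rule dyadic_pattern_sweeping[where w = w and e = e and start = i0,
      OF L(1) pos log' \<alpha> nz ratio small])
qed

section \<open>Perturbed powers\<close>

theorem lacunary_perturbation_not_khintchin:
  fixes l :: "nat \<Rightarrow> nat" and \<theta> :: "nat \<Rightarrow> real" and e :: "nat \<Rightarrow> int" and \<alpha> \<rho> :: real
  assumes pos: "\<And>n. n \<ge> 1 \<Longrightarrow> l n > 0"
    and log: "\<And>n. n \<ge> 1 \<Longrightarrow> ln (real (l n)) = \<alpha> * of_int (e n) + \<theta> n" and \<alpha>: "\<alpha> > 0"
    and \<rho>: "0 < \<rho>" "\<rho> < 1"
    and lac: "\<And>n. n \<ge> start \<Longrightarrow> 0 < \<bar>\<theta> (Suc n)\<bar> \<and> \<bar>\<theta> (Suc n)\<bar> \<le> \<rho> * \<bar>\<theta> n\<bar>"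
    and q: "q = \<infinity> \<or> q = 1"
  shows "\<not> khintchin q l"
proof -
  have "\<exists>c>0. sweeping l c"
    by (rule lacunary_sweeping[where \<theta> = \<theta> and e = e and start = start and \<rho> = \<rho> and \<alpha> = \<alpha>])
      (fact pos log \<alpha> \<rho> lac)+
  then show ?thesis using not_khintchin_if_sweeping q by blast
qed

lemma ln_perturbed_power:
  fixes a x y :: real and e :: int
  assumes "a > 0" "x > 0" "x = a powi e + y"
  shows "ln x = ln a * of_int e + ln (1 + y * a powi (- e))"
proof -
  have ae: "a powi e > 0" using assms(1) by simp
  have "x = a powi e * (1 + y * a powi (- e))"
    using ae assms(1,3) by (simp add: power_int_minus field_simps)
  moreover from this have "1 + y * a powi (- e) > 0"
    using ae assms(2) by (metis zero_less_mult_pos)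
  ultimately have "ln x = ln (a powi e) + ln (1 + y * a powi (- e))"
    using ae by (simp add: ln_mult)
  moreover have "ln (a powi e) = ln a * of_int e"
    using assms(1) by (simp add: powr_real_of_int'[symmetric] ln_powr)
  ultimately show ?thesis by simp
qed

text \<open>
  Near \<open>0\<close> the logarithm \<open>ln (1 + y)\<close> lies between \<open>0.9 y\<close> and \<open>1.1 y\<close> in absolute value, and
  \<open>1.1/0.9 \<cdot> 1/2 < 3/4\<close>.
\<close>

lemma ln_one_plus_halving:
  fixes y y' :: real
  assumes "y' \<noteq> 0" "\<bar>y'\<bar> \<le> \<bar>y\<bar> / 2" "\<bar>y\<bar> \<le> 1/20"
  shows "0 < \<bar>ln (1 + y')\<bar> \<and> \<bar>ln (1 + y')\<bar> \<le> 3/4 * \<bar>ln (1 + y)\<bar>"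
proof -
  have bnd: "\<bar>ln (1 + x) - x\<bar> \<le> \<bar>x\<bar> / 10" if "\<bar>x\<bar> \<le> 1/20" for x :: real
  proof -
    have "\<bar>ln (1 + x) - x\<bar> \<le> 2 * x\<^sup>2" using that by (intro abs_ln_one_plus_x_minus_x_bound) auto
    also have "2 * x\<^sup>2 = 2 * \<bar>x\<bar> * \<bar>x\<bar>" by (simp add: power2_eq_square flip: abs_mult)
    also have "\<dots> \<le> 2 * (1/20) * \<bar>x\<bar>" using that by (intro mult_right_mono) auto
    finally show ?thesis by simp
  qed
  have "\<bar>y'\<bar> > 0" using assms(1) by simp
  with bnd[of y] bnd[of y'] assms(2,3) show ?thesis by linarith
qed

text \<open>
  The polynomial \<open>p(x) - p(x + 1)\<close> has infinitely many roots, so it is zero.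
\<close>

lemma int_poly_nat_const:
  fixes p :: "int poly"
  assumes "infinite {n::nat. poly p (int n) = poly p (int n + 1)}"
  shows "poly p (int n) = poly p 0"
proof -
  define d where "d = p - p \<circ>\<^sub>p [:1, 1:]"
  have d: "poly d x = poly p x - poly p (x + 1)" for x
    by (simp add: d_def poly_pcompose add.commute)
  have "infinite (int ` {n::nat. poly p (int n) = poly p (int n + 1)})"
    using assms by (simp add: finite_image_iff)
  moreover have "int ` {n::nat. poly p (int n) = poly p (int n + 1)} \<subseteq> {x. poly d x = 0}"
    by (auto simp: d)
  ultimately have "infinite {x. poly d x = 0}" using finite_subset by blast
  then have "d = 0" using poly_roots_finite by blast
  then have step: "poly p (x + 1) = poly p x" for x using d[of x] by simp
  show ?thesis
  proof (induction n)
    case (Suc n)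
    then show ?case using step[of "int n"] by (simp add: add.commute)
  qed simp
qed

text \<open>
  If \<open>p\<close> is not constant, then it eventually increases by at least \<open>1\<close> at each step, so the relative
  perturbation \<open>c a\<^bsup>-p(n)\<^esup>\<close> is at least halved at each step.
\<close>

lemma power_shift_not_khintchin:
  fixes a c :: int and p :: "int poly" and l :: "nat \<Rightarrow> nat"
  assumes a: "a \<ge> 2" and inc: "eventually_increasing p" and c: "c \<noteq> 0"
    and l: "\<And>n. n > h \<Longrightarrow> l n > 0 \<and> real (l n) = real_of_int a powi poly p (int n) + real_of_int c"
    and q: "q = \<infinity> \<or> q = 1"
  shows "\<not> khintchin q (\<lambda>n. l (n + h))"
proof (cases "finite {n::nat. poly p (int n) = poly p (int n + 1)}")
  case False
  have "real (l (n + h)) = real_of_int a powi poly p 0 + real_of_int c" if "n \<ge> 1" for n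
    using l[of "n + h"] that int_poly_nat_const[OF False, of "n + h"] by simp
  then have "l (n + h) = nat \<lfloor>real_of_int a powi poly p 0 + real_of_int c\<rfloor>" if "n \<ge> 1" for n
    using that by (metis floor_of_nat nat_int)
  then show ?thesis by (rule not_khintchin_const[OF _ q])
next
  case True
  define A where "A = real_of_int a"
  have A: "A \<ge> 2" using a by (simp add: A_def)
  obtain n1 where n1: "mono_on {n1..} (\<lambda>n::nat. poly p (int n))"
    using inc unfolding eventually_increasing_def by blast
  obtain n2 where n2: "\<And>n::nat. poly p (int n) = poly p (int n + 1) \<Longrightarrow> n < n2"
    using True unfolding finite_nat_set_iff_bounded by blast
  define m where "m = max n1 n2"
  have step: "poly p (int n) + 1 \<le> poly p (int (Suc n))" if "n \<ge> m" for n
  proof -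
    have "poly p (int n) \<le> poly p (int (Suc n))"
      using that by (intro mono_onD[OF n1]) (auto simp: m_def)
    moreover have "poly p (int n) \<noteq> poly p (int (Suc n))"
      using n2[of n] that by (auto simp: m_def add.commute)
    ultimately show ?thesis by simp
  qed
  define y where "y n = real_of_int c * A powi (- poly p (int n))" for n
  have y0: "y n \<noteq> 0" for n using A c by (simp add: y_def)
  have half: "\<bar>y (Suc n)\<bar> \<le> \<bar>y n\<bar> / 2" if "n \<ge> m" for n
  proof -
    have "A powi (- poly p (int (Suc n))) \<le> A powi (- poly p (int n) - 1)"
      using step[OF that] A by (intro power_int_increasing) auto
    also have "\<dots> = A powi (- poly p (int n)) / A" using A by (simp add: power_int_diff)
    also have "\<dots> \<le> A powi (- poly p (int n)) / 2" using A by (intro divide_left_mono) auto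
    finally have "A powi (- poly p (int (Suc n))) \<le> A powi (- poly p (int n)) / 2" .
    then have "\<bar>real_of_int c\<bar> * A powi (- poly p (int (Suc n))) \<le> \<bar>real_of_int c\<bar> * (A powi (- poly p (int n)) / 2)"
      by (intro mult_left_mono) auto
    then show ?thesis using A by (simp add: y_def abs_mult)
  qed
  have decay: "\<bar>y (m + d)\<bar> \<le> \<bar>y m\<bar> * (1/2) ^ d" for d
  proof (induction d)
    case (Suc d)
    then show ?case using half[of "m + d"] by simp
  qed simp
  have "(\<lambda>d. \<bar>y m\<bar> * (1/2) ^ d) \<longlonglongrightarrow> 0"
    by (intro tendsto_mult_right_zero LIMSEQ_realpow_zero) auto
  then have "\<forall>\<^sub>F d in sequentially. \<bar>y m\<bar> * (1/2) ^ d < 1/20"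
    by (rule order_tendstoD) simp
  then obtain d0 where d0: "\<And>d. d \<ge> d0 \<Longrightarrow> \<bar>y m\<bar> * (1/2) ^ d < 1/20"
    by (auto simp: eventually_sequentially)
  have small: "\<bar>y n\<bar> \<le> 1/20" if "n \<ge> m + d0" for n
  proof -
    have "m + (n - m) = n" "d0 \<le> n - m" using that by linarith+
    then show ?thesis using decay[of "n - m"] d0[of "n - m"] by simp
  qed
  have lac: "0 < \<bar>ln (1 + y (Suc n + h))\<bar> \<and> \<bar>ln (1 + y (Suc n + h))\<bar> \<le> 3/4 * \<bar>ln (1 + y (n + h))\<bar>"
    if "n \<ge> m + d0" for n
    using ln_one_plus_halving[OF y0 half[of "n + h"] small[of "n + h"]] that by simp
  have log: "ln (real (l (n + h))) = ln A * of_int (poly p (int (n + h))) + ln (1 + y (n + h))"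
    if "n \<ge> 1" for n
    unfolding y_def using l[of "n + h"] that A by (intro ln_perturbed_power) (auto simp: A_def)
  have pos: "l (n + h) > 0" if "n \<ge> 1" for n using l[of "n + h"] that by simp
  show ?thesis
    by (rule lacunary_perturbation_not_khintchin[where l = "\<lambda>n. l (n + h)" and \<alpha> = "ln A" and \<rho> = "3/4" and start = "m + d0"
          and \<theta> = "\<lambda>n. ln (1 + y (n + h))" and e = "\<lambda>n. poly p (int (n + h))", OF pos log _ _ _ lac q])
      (use A in auto)
qed

theorem theorem1p1:
  fixes a :: int and p :: "int poly"
  assumes "a \<ge> 2"
    and "eventually_increasing p"
    and "eventually_nonneg p"
  shows "(\<forall>(f :: nat \<Rightarrow> int) (l :: nat \<Rightarrow> nat) (\<theta> :: nat \<Rightarrow> real).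
            (\<forall>n\<ge>1. l n > 0 \<and>
               real (l n) = real_of_int a powi poly p (int n) + real_of_int (f n)) \<longrightarrow>
            (\<forall>n\<ge>1. \<theta> n = ln (1 + real_of_int (f n) * real_of_int a powi (- poly p (int n)))) \<longrightarrow>
            (\<exists>(\<rho>::real) (n0::nat). 0 < \<rho> \<and> \<rho> < 1 \<and> n0 \<ge> 1 \<and>
               (\<forall>n\<ge>n0. 0 < \<bar>\<theta> (n + 1)\<bar> \<and> \<bar>\<theta> (n + 1)\<bar> \<le> \<rho> * \<bar>\<theta> n\<bar>)) \<longrightarrow>
            \<not> khintchin \<infinity> l \<and> \<not> khintchin 1 l)
       \<and> (\<forall>(c :: int) (h :: nat) (l :: nat \<Rightarrow> nat).
            c \<noteq> 0 \<longrightarrow>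
            (\<forall>n>h. l n > 0 \<and>
               real (l n) = real_of_int a powi poly p (int n) + real_of_int c) \<longrightarrow>
            \<not> khintchin \<infinity> (\<lambda>n. l (n + h)) \<and> \<not> khintchin 1 (\<lambda>n. l (n + h)))"
proof -
  have a: "real_of_int a > 0" "ln (real_of_int a) > 0" using assms(1) by auto
  have perturbed: "\<not> khintchin q l"
    if l: "\<forall>n\<ge>1. l n > 0 \<and> real (l n) = real_of_int a powi poly p (int n) + real_of_int (f n)"
      and \<theta>: "\<forall>n\<ge>1. \<theta> n = ln (1 + real_of_int (f n) * real_of_int a powi (- poly p (int n)))"
      and lac: "\<exists>(\<rho>::real) (n0::nat). 0 < \<rho> \<and> \<rho> < 1 \<and> n0 \<ge> 1 \<and>
        (\<forall>n\<ge>n0. 0 < \<bar>\<theta> (n + 1)\<bar> \<and> \<bar>\<theta> (n + 1)\<bar> \<le> \<rho> * \<bar>\<theta> n\<bar>)"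
      and q: "q = \<infinity> \<or> q = 1"
    for q l \<theta> and f :: "nat \<Rightarrow> int"
  proof -
    obtain \<rho> n0 where \<rho>: "0 < \<rho>" "\<rho> < 1"
      and lac': "\<And>n. n \<ge> n0 \<Longrightarrow> 0 < \<bar>\<theta> (Suc n)\<bar> \<and> \<bar>\<theta> (Suc n)\<bar> \<le> \<rho> * \<bar>\<theta> n\<bar>"
      using lac by auto
    have log: "ln (real (l n)) = ln (real_of_int a) * of_int (poly p (int n)) + \<theta> n" if "n \<ge> 1" for n
    proof -
      from l that have "real (l n) > 0"
        "real (l n) = real_of_int a powi poly p (int n) + real_of_int (f n)" by auto
      from ln_perturbed_power[OF a(1) this] show ?thesis using \<theta> that by simp
    qed
    show ?thesis
      by (rule lacunary_perturbation_not_khintchin[where l = l and e = "\<lambda>n. poly p (int n)" and \<theta> = \<theta>,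
            OF _ log a(2) \<rho> lac' q]) (use l in auto)
  qed
  show ?thesis
    by (intro conjI allI impI) ((rule perturbed, assumption, assumption, assumption, simp)+,
        (rule power_shift_not_khintchin[OF assms(1,2)], assumption, blast, simp)+)
qed

end
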